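(* Let $(X,W)$ be a Landau–Ginzburg pair, $\Omega$ a holomorphic volume form on $X$, $G$ a Kähler metric on $X$, and $\mathbf a=(E,h,D)$ a Hermitian holomorphic factorization of $W$ with underlying holomorphic factorization $a=(E,D)$. Let $\lambda\ge0$. For any $\omega\in\mathrm{PV}_c(X)$ and any $\alpha\in\mathrm{End}_{\mathrm{DF}_c(X,W)}(a)$, we have $$\mathrm{Tr}^{(\lambda)}\big(\omega f^B_{\mathbf a}(\alpha)\big)=\mathrm{tr}^{(\lambda)}_{\mathbf a}\big(e^{(\lambda)}_{\mathbf a}(\omega)\alpha\big)=\int_X\Omega\wedge\lambda_\Omega\big(e^{-\lambda L_G}\omega\,\Pi_{\mathbf a}\,\alpha\big).$$
   Context: Landau–Ginzburg pair: $X$ is a connected, paracompact, non-compact complex manifold of dimension $d\ge1$ which admits a Kähler metric and whose canonical bundle $\wedge^dT^*X$ is holomorphically trivial; $W:X\to\mathbb C$ is a non-constant holomorphic function. A holomorphic volume form is a nowhere-vanishing holomorphic section of $\wedge^dT^*X$. $TX$ is the holomorphic tangent bundle; $\mathcal A(X,E)$ is the space of smooth $(0,* )$-forms valued in $E$, $\mathcal A(X)$ the space of smooth $(0,* )$-forms; $\Gamma_\infty$ denotes smooth sections, subscript $c$ compact support. $\mathrm{PV}(X)=\mathcal A(X,\wedge TX)=\bigoplus\mathrm{PV}^{i,j}(X)$ ($-d\le i\le0$, $0\le j\le d$), $\mathrm{PV}^{i,j}(X)=\Omega^{0,j}(X,\wedge^{|i|}TX)$, with product $(\rho_1\otimes P_1)(\rho_2\otimes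 P_2)=(-1)^{ij}(\rho_1\wedge\rho_2)\otimes(P_1\wedge P_2)$ for $P_1$ of polyvector degree $i$, $\rho_2$ of form degree $j$, graded by $i+j$. A holomorphic factorization of $W$ is $a=(E,D)$ with $E=E^{\hat0}\oplus E^{\hat1}$ a $\mathbb Z_2$-graded holomorphic vector bundle and $D$ an odd holomorphic section of $\mathrm{End}(E)$ with $D^2=W\,\mathrm{id}_E$; $\mathbf a=(E,h,D)$ is Hermitian if $h$ is a Hermitian metric on $E$ with $E^{\hat0}\perp E^{\hat1}$. $\mathrm{End}_{\mathrm{DF}_c(X,W)}(a)=\mathcal A_c(X,\mathrm{End}(E))$, with product $(\rho\otimes f)(\eta\otimes g)=(-1)^{\sigma(f)\mathrm{rk}\eta}(\rho\wedge\eta)\otimes(f\circ g)$ ($\mathrm{rk}$ = form degree, $\sigma$ = bundle degree). $\mathrm{PV}(X,\mathrm{End}(E))=\mathrm{PV}(X)\hat\otimes_{C^\infty(X)}\Gamma_\infty(X,\mathrm{End}(E))$ with $(\omega_1\otimes s_1)(\omega_2\otimes s_2)=(-1)^{\sigma(s_1)\deg\omega_2}\omega_1\omega_2\otimes s_1s_2$; it contains $\mathrm{PV}(X)$ and $\mathcal A(X,\mathrm{End}(E))$ as subalgebras; $\mathrm{str}(\omega\otimes s)=\omega\,\mathrm{str}(s)$ defines $\mathrm{str}:\mathrm{PV}(X,\mathrm{End}(E))\to\mathrm{PV}(X)$, restricting to $\mathcal A(X,\mathrm{End}(E))\to\mathcal A(X)$. The reduced contraction $\Omega\lrcorner_0$,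 from $\mathrm{PV}(X,\mathrm{End}(E))$ to $\mathcal A(X,\mathrm{End}(E))$ and from $\mathrm{PV}(X)$ to $\mathcal A(X)$, is given by $\Omega\lrcorner_0(P\beta)=(\Omega\lrcorner P)\beta$ for $P\in\Gamma_\infty(X,\wedge^dTX)$ and $\beta\in\mathcal A(X,\mathrm{End}(E))$ (resp. $\mathcal A(X)$), and $0$ for $P$ of polyvector degree $<d$, with $(dz^1\wedge\dots\wedge dz^d)\lrcorner(\partial_1\wedge\dots\wedge\partial_d)=(-1)^{d(d-1)/2}$. $\lambda_\Omega=(\Omega\lrcorner_0)\circ\mathrm{str}=\mathrm{str}\circ(\Omega\lrcorner_0):\mathrm{PV}(X,\mathrm{End}(E))\to\mathcal A(X)$ (the symbol $\lambda_\Omega$ is unrelated to the number $\lambda$). Let $\nabla$ be the Chern connection of $(E,h)$ with curvature $F=\sum F_{i\bar j}dz^i\wedge d\bar z^j$, $\omega_G=\sum\mathbf i\,G_{i\bar j}dz^i\wedge d\bar z^j$ the Kähler form, $\Omega=\varphi\,dz^1\wedge\dots\wedge dz^d$ locally, $\theta_i=\partial_i$, $V_i=\nabla_iD+\sum_jd\bar z^j(F_{i\bar j}-\mathbf i\,G_{i\bar j}\mathrm{id}_E)$. The disk kernel is the globally defined element $\Pi_{\mathbf a}=\frac1{d!\,\varphi}\sum\epsilon^{i_1\dots i_d}(\theta_{i_1}\mathrm{id}_E+\mathbf iV_{i_1})\cdots(\theta_{i_d}\mathrm{id}_E+\mathbf iV_{i_d})\in\mathrm{PV}(X,\mathrm{End}(E))$.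 $e^B_{\mathbf a}(\omega)=\Omega\lrcorner_0(\omega\,\Pi_{\mathbf a})$ and $f^B_{\mathbf a}(\alpha)=\mathrm{str}(\Pi_{\mathbf a}\alpha)$. Let $h_G$ be the Hermitian metric induced by $G$ on $TX$, $\mathrm{grad}_G\overline W=\sum g^i\partial_i$ the section of $TX$ with $(\bar\partial\,\overline W)(\bar s)=h_G(\mathrm{grad}_G\overline W,s)$, $H_G=\bar\partial_{TX}(\mathrm{grad}_G\overline W)\in\mathrm{PV}^{-1,1}(X)$, $\|\partial W\|_G^2=h_G(\mathrm{grad}_G\overline W,\mathrm{grad}_G\overline W)$, $L_G=\|\partial W\|^2_G+\mathbf iH_G$, and $L^G_{\mathbf a}=\|\partial W\|^2_G\mathrm{id}_E+N$ with $N=\sum_i(\bar\partial g^i)(\nabla_iD+\sum_jd\bar z^jF_{i\bar j})\in\mathcal A(X,\mathrm{End}(E))$. The exponentials $e^{tL_G}$, $e^{tL^G_{\mathbf a}}$ ($t\in\mathbb R$) are formed in $\mathrm{PV}(X)$, $\mathcal A(X,\mathrm{End}(E))$ ($H_G$, $N$ are nilpotent). Tempered maps: $\mathrm{Tr}^{(\lambda)}(\omega)=\int_X\Omega\wedge(\Omega\lrcorner_0(e^{-\lambda L_G}\omega))$ for $\omega\in\mathrm{PV}_c(X)$; $\mathrm{tr}^{(\lambda)}_{\mathbf a}(\alpha)=\int_X\Omega\wedge\mathrm{str}(e^{-\lambda L^G_{\mathbf a}}\alpha)$ for $\alpha\in\mathcal A_c(X,\mathrm{End}(E))$; $e^{(\lambda)}_{\mathbf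 a}(\omega)=e^{\lambda L^G_{\mathbf a}}\,e^B_{\mathbf a}(e^{-\lambda L_G}\omega)$. *)

theory Defs
  imports "HOL-Analysis.Analysis"
begin

section \<open>Calculus on open subsets of complex coordinate space\<close>

text \<open>The complex dimension is the cardinality of the index type \<open>'d\<close>; its linear order fixes the
  order of the factors in \<open>dz\<^sup>1 \<and> \<dots> \<and> dz\<^sup>d\<close>, \<open>\<partial>\<^sub>1 \<and> \<dots> \<and> \<partial>\<^sub>d\<close> and so on.\<close>

definition dir_deriv :: "'a::real_normed_vector \<Rightarrow> ('a \<Rightarrow> 'b::real_normed_vector) \<Rightarrow> 'a \<Rightarrow> 'b" where
  "dir_deriv v f z = frechet_derivative f (at z) v"

text \<open>On an open set: all iterated directional derivatives exist and are differentiable, i.e.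
  \<open>f\<close> is infinitely often differentiable in the real sense.\<close>

definition smooth_on :: "'a::real_normed_vector set \<Rightarrow> ('a \<Rightarrow> 'b::real_normed_vector) \<Rightarrow> bool" where
  "smooth_on S f \<longleftrightarrow> (\<forall>vs. \<forall>z\<in>S. foldr dir_deriv vs f differentiable (at z))"

definition wirtinger :: "'d::finite \<Rightarrow> (complex ^ 'd \<Rightarrow> complex) \<Rightarrow> complex ^ 'd \<Rightarrow> complex" where
  "wirtinger i f z = (dir_deriv (axis i 1) f z - \<i> * dir_deriv (axis i \<i>) f z) / 2"

definition wirtinger_bar :: "'d::finite \<Rightarrow> (complex ^ 'd \<Rightarrow> complex) \<Rightarrow> complex ^ 'd \<Rightarrow> complex" where
  "wirtinger_bar i f z = (dir_deriv (axis i 1) f z + \<i> * dir_deriv (axis i \<i>) f z) / 2"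

definition multi_holomorphic_on :: "(complex ^ 'd::finite) set \<Rightarrow> (complex ^ 'd \<Rightarrow> complex) \<Rightarrow> bool" where
  "multi_holomorphic_on S f \<longleftrightarrow>
     (\<forall>z\<in>S. f differentiable (at z) \<and> (\<forall>i. wirtinger_bar i f z = 0))"


section \<open>Complex manifolds\<close>

type_synonym ('x, 'd) chart = "'x set \<times> ('x \<Rightarrow> (complex, 'd) vec)"

record ('x, 'd) cmanifold =
  mtop :: "'x topology"
  matlas :: "('x, 'd) chart set"

abbreviation chart_inv :: "('x, 'd) chart \<Rightarrow> (complex, 'd) vec \<Rightarrow> 'x" where
  "chart_inv c \<equiv> inv_into (fst c) (snd c)"

definition smooth_fun ::
    "('x, 'd::finite) cmanifold \<Rightarrow> 'x set \<Rightarrow> ('x \<Rightarrow> 'b::real_normed_vector) \<Rightarrow> bool" where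
  "smooth_fun M S f \<longleftrightarrow>
     (\<forall>c\<in>matlas M. smooth_on (snd c ` (fst c \<inter> S)) (f \<circ> chart_inv c))"

definition holo_fun :: "('x, 'd::finite) cmanifold \<Rightarrow> 'x set \<Rightarrow> ('x \<Rightarrow> complex) \<Rightarrow> bool" where
  "holo_fun M S f \<longleftrightarrow>
     (\<forall>c\<in>matlas M. multi_holomorphic_on (snd c ` (fst c \<inter> S)) (f \<circ> chart_inv c))"

definition complex_manifold :: "('x, 'd::finite) cmanifold \<Rightarrow> bool" where
  "complex_manifold M \<longleftrightarrow>
     Hausdorff_space (mtop M) \<and>
     \<Union> (fst ` matlas M) = topspace (mtop M) \<and>
     (\<forall>c\<in>matlas M. openin (mtop M) (fst c) \<and> open (snd c ` fst c) \<and>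
        homeomorphic_map (subtopology (mtop M) (fst c)) (top_of_set (snd c ` fst c)) (snd c)) \<and>
     (\<forall>c\<in>matlas M. \<forall>k. holo_fun M (fst c) (\<lambda>p. snd c p $ k))"

definition paracompact_top :: "'x topology \<Rightarrow> bool" where
  "paracompact_top T \<longleftrightarrow>
     (\<forall>\<U>. (\<forall>U\<in>\<U>. openin T U) \<and> \<Union>\<U> = topspace T \<longrightarrow>
        (\<exists>\<V>. (\<forall>V\<in>\<V>. openin T V \<and> (\<exists>U\<in>\<U>. V \<subseteq> U)) \<and> \<Union>\<V> = topspace T \<and>
             locally_finite_in T \<V>))"

text \<open>Coordinate derivatives \<open>\<partial>/\<partial>z\<^sup>i\<close> and \<open>\<partial>/\<partial>\<bar>z\<^sup>i\<close> in the chart \<open>c\<close> of a function on the manifold.\<close>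

definition chart_d :: "('x, 'd::finite) chart \<Rightarrow> 'd \<Rightarrow> ('x \<Rightarrow> complex) \<Rightarrow> 'x \<Rightarrow> complex" where
  "chart_d c i f p = wirtinger i (f \<circ> chart_inv c) (snd c p)"

definition chart_dbar :: "('x, 'd::finite) chart \<Rightarrow> 'd \<Rightarrow> ('x \<Rightarrow> complex) \<Rightarrow> 'x \<Rightarrow> complex" where
  "chart_dbar c i f p = wirtinger_bar i (f \<circ> chart_inv c) (snd c p)"

text \<open>\<open>jacobian c c' p k i\<close> is \<open>\<partial>w\<^sup>k/\<partial>z\<^sup>i\<close> for the coordinates \<open>z\<close> of \<open>c\<close> and \<open>w\<close> of \<open>c'\<close>.\<close>

definition jacobian ::
    "('x, 'd::finite) chart \<Rightarrow> ('x, 'd) chart \<Rightarrow> 'x \<Rightarrow> 'd \<Rightarrow> 'd \<Rightarrow> complex" where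
  "jacobian c c' p k i = chart_d c i (\<lambda>q. snd c' q $ k) p"


section \<open>Holomorphic volume forms, Kaehler metrics, Landau-Ginzburg pairs\<close>

text \<open>A volume form is given by its coefficient functions: \<open>\<Omega> = (Om c) dz\<^sup>1 \<and> \<dots> \<and> dz\<^sup>d\<close> in the
  chart \<open>c\<close>.\<close>

definition holomorphic_volume_form ::
    "('x, 'd::finite) cmanifold \<Rightarrow> (('x, 'd) chart \<Rightarrow> 'x \<Rightarrow> complex) \<Rightarrow> bool" where
  "holomorphic_volume_form M Om \<longleftrightarrow>
     (\<forall>c\<in>matlas M. holo_fun M (fst c) (Om c) \<and> (\<forall>p\<in>fst c. Om c p \<noteq> 0)) \<and>
     (\<forall>c\<in>matlas M. \<forall>c'\<in>matlas M. \<forall>p\<in>fst c \<inter> fst c'.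
        Om c p = det (\<chi> k i. jacobian c c' p k i) * Om c' p)"

text \<open>A metric is given by the coefficients \<open>G c p i j\<close>, standing for \<open>G\<^bsub>i\<bar>j\<^esub> = h\<^sub>G(\<partial>\<^sub>i, \<partial>\<^sub>j)\<close>; Hermitian
  forms are linear in the first and antilinear in the second argument. The last two conditions
  are the vanishing of the components of type (2,1) and (1,2) of \<open>d\<omega>\<^sub>G\<close>,
  where \<open>\<omega>\<^sub>G = \<Sum> \<i> G\<^bsub>i\<bar>j\<^esub> dz\<^sup>i \<and> d\<bar>z\<^sup>j\<close>.\<close>

definition kaehler_metric ::
    "('x, 'd::finite) cmanifold \<Rightarrow> (('x, 'd) chart \<Rightarrow> 'x \<Rightarrow> 'd \<Rightarrow> 'd \<Rightarrow> complex) \<Rightarrow> bool" where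
  "kaehler_metric M G \<longleftrightarrow>
     (\<forall>c\<in>matlas M. \<forall>i j. smooth_fun M (fst c) (\<lambda>p. G c p i j)) \<and>
     (\<forall>c\<in>matlas M. \<forall>c'\<in>matlas M. \<forall>p\<in>fst c \<inter> fst c'. \<forall>i j.
        G c p i j = (\<Sum>k\<in>UNIV. \<Sum>l\<in>UNIV. jacobian c c' p k i * cnj (jacobian c c' p l j) * G c' p k l)) \<and>
     (\<forall>c\<in>matlas M. \<forall>p\<in>fst c.
        (\<forall>i j. G c p j i = cnj (G c p i j)) \<and>
        (\<forall>v. (\<exists>i. v i \<noteq> 0) \<longrightarrow> Re (\<Sum>i\<in>UNIV. \<Sum>j\<in>UNIV. v i * cnj (v j) * G c p i j) > 0) \<and>
        (\<forall>i j k. chart_d c k (\<lambda>q. G c q i j) p = chart_d c i (\<lambda>q. G c q k j) p) \<and>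
        (\<forall>i j k. chart_dbar c k (\<lambda>q. G c q i j) p = chart_dbar c j (\<lambda>q. G c q i k) p))"

definition landau_ginzburg_pair :: "('x, 'd::finite) cmanifold \<Rightarrow> ('x \<Rightarrow> complex) \<Rightarrow> bool" where
  "landau_ginzburg_pair M W \<longleftrightarrow>
     complex_manifold M \<and> connected_space (mtop M) \<and> paracompact_top (mtop M) \<and>
     \<not> compact_space (mtop M) \<and>
     (\<exists>G. kaehler_metric M G) \<and> (\<exists>Om. holomorphic_volume_form M Om) \<and>
     holo_fun M (topspace (mtop M)) W \<and> \<not> W constant_on topspace (mtop M)"


section \<open>Graded bundles, holomorphic factorizations, Hermitian metrics\<close>

text \<open>A local trivialization over \<open>U\<close> sends a vector over \<open>p \<in> U\<close> to its components, indexed by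
  \<open>{..<rk0 + rk1}\<close> and padded by \<open>0\<close>. Indices below \<open>rk0\<close> belong to the even summand, the others to the
  odd one. The ranks are constant because the base will be connected.\<close>

type_synonym ('x, 'e) triv = "'x set \<times> ('e \<Rightarrow> nat \<Rightarrow> complex)"

record ('x, 'e) gbundle =
  btotal :: "'e set"
  bproj :: "'e \<Rightarrow> 'x"
  rk0 :: nat
  rk1 :: nat
  trivs :: "('x, 'e) triv set"

definition rk :: "('x, 'e) gbundle \<Rightarrow> nat" where
  "rk B = rk0 B + rk1 B"

definition par :: "('x, 'e) gbundle \<Rightarrow> nat \<Rightarrow> nat" where
  "par B a = (if a < rk0 B then 0 else 1)"

definition fib :: "('x, 'e) gbundle \<Rightarrow> 'x \<Rightarrow> 'e set" where
  "fib B p = {e \<in> btotal B. bproj B e = p}"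

definition frame_vec :: "('x, 'e) gbundle \<Rightarrow> ('x, 'e) triv \<Rightarrow> 'x \<Rightarrow> nat \<Rightarrow> 'e" where
  "frame_vec B t p b = inv_into (fib B p) (snd t) (\<lambda>a. if a = b then 1 else 0)"

definition transition ::
    "('x, 'e) gbundle \<Rightarrow> ('x, 'e) triv \<Rightarrow> ('x, 'e) triv \<Rightarrow> 'x \<Rightarrow> nat \<Rightarrow> nat \<Rightarrow> complex" where
  "transition B t t' p a b = snd t' (frame_vec B t p b) a"

text \<open>The transition matrices are linear in the fibre, holomorphic in the base point and even. So each
  fibre has a well-defined structure of graded vector space, and the total space has a well-defined
  topology and complex structure.\<close>

definition holomorphic_graded_bundle ::
    "('x, 'd::finite) cmanifold \<Rightarrow> ('x, 'e) gbundle \<Rightarrow> bool" where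
  "holomorphic_graded_bundle M B \<longleftrightarrow>
     bproj B ` btotal B \<subseteq> topspace (mtop M) \<and>
     \<Union> (fst ` trivs B) = topspace (mtop M) \<and>
     (\<forall>t\<in>trivs B. openin (mtop M) (fst t) \<and>
        (\<forall>p\<in>fst t. bij_betw (snd t) (fib B p) {v. \<forall>a\<ge>rk B. v a = 0})) \<and>
     (\<forall>t\<in>trivs B. \<forall>t'\<in>trivs B.
        (\<forall>p\<in>fst t \<inter> fst t'. \<forall>e\<in>fib B p. \<forall>a<rk B.
           snd t' e a = (\<Sum>b<rk B. transition B t t' p a b * snd t e b)) \<and>
        (\<forall>a<rk B. \<forall>b<rk B. holo_fun M (fst t \<inter> fst t') (\<lambda>p. transition B t t' p a b)) \<and>
        (\<forall>p\<in>fst t \<inter> fst t'. \<forall>a<rk B. \<forall>b<rk B.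
           par B a \<noteq> par B b \<longrightarrow> transition B t t' p a b = 0))"

text \<open>\<open>D t p\<close> is the matrix of \<open>D\<close> in the frame of \<open>t\<close>, acting on columns of components.\<close>

definition holomorphic_factorization ::
    "('x, 'd::finite) cmanifold \<Rightarrow> ('x \<Rightarrow> complex) \<Rightarrow> ('x, 'e) gbundle \<Rightarrow>
     (('x, 'e) triv \<Rightarrow> 'x \<Rightarrow> nat \<Rightarrow> nat \<Rightarrow> complex) \<Rightarrow> bool" where
  "holomorphic_factorization M W B D \<longleftrightarrow>
     holomorphic_graded_bundle M B \<and>
     (\<forall>t\<in>trivs B. \<forall>a<rk B. \<forall>b<rk B. holo_fun M (fst t) (\<lambda>p. D t p a b)) \<and>
     (\<forall>t\<in>trivs B. \<forall>t'\<in>trivs B. \<forall>p\<in>fst t \<inter> fst t'. \<forall>a<rk B. \<forall>b<rk B.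
        (\<Sum>k<rk B. D t' p a k * transition B t t' p k b) =
        (\<Sum>k<rk B. transition B t t' p a k * D t p k b)) \<and>
     (\<forall>t\<in>trivs B. \<forall>p\<in>fst t. \<forall>a<rk B. \<forall>b<rk B.
        (par B a = par B b \<longrightarrow> D t p a b = 0) \<and>
        (\<Sum>k<rk B. D t p a k * D t p k b) = (if a = b then W p else 0))"

text \<open>\<open>h t p a b\<close> is \<open>h(e\<^sub>a, e\<^sub>b)\<close> for the frame \<open>e\<close> of \<open>t\<close>.\<close>

definition hermitian_bundle_metric ::
    "('x, 'd::finite) cmanifold \<Rightarrow> ('x, 'e) gbundle \<Rightarrow>
     (('x, 'e) triv \<Rightarrow> 'x \<Rightarrow> nat \<Rightarrow> nat \<Rightarrow> complex) \<Rightarrow> bool" where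
  "hermitian_bundle_metric M B h \<longleftrightarrow>
     (\<forall>t\<in>trivs B. \<forall>a<rk B. \<forall>b<rk B. smooth_fun M (fst t) (\<lambda>p. h t p a b)) \<and>
     (\<forall>t\<in>trivs B. \<forall>t'\<in>trivs B. \<forall>p\<in>fst t \<inter> fst t'. \<forall>a<rk B. \<forall>b<rk B.
        h t p a b = (\<Sum>k<rk B. \<Sum>l<rk B.
          transition B t t' p k a * cnj (transition B t t' p l b) * h t' p k l)) \<and>
     (\<forall>t\<in>trivs B. \<forall>p\<in>fst t.
        (\<forall>a<rk B. \<forall>b<rk B. h t p b a = cnj (h t p a b)) \<and>
        (\<forall>v. (\<exists>a<rk B. v a \<noteq> 0) \<longrightarrow> Re (\<Sum>a<rk B. \<Sum>b<rk B. v a * cnj (v b) * h t p a b) > 0))"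

definition hermitian_factorization ::
    "('x, 'd::finite) cmanifold \<Rightarrow> ('x \<Rightarrow> complex) \<Rightarrow> ('x, 'e) gbundle \<Rightarrow>
     (('x, 'e) triv \<Rightarrow> 'x \<Rightarrow> nat \<Rightarrow> nat \<Rightarrow> complex) \<Rightarrow>
     (('x, 'e) triv \<Rightarrow> 'x \<Rightarrow> nat \<Rightarrow> nat \<Rightarrow> complex) \<Rightarrow> bool" where
  "hermitian_factorization M W B h D \<longleftrightarrow>
     holomorphic_factorization M W B D \<and> hermitian_bundle_metric M B h \<and>
     (\<forall>t\<in>trivs B. \<forall>p\<in>fst t. \<forall>a<rk B. \<forall>b<rk B. par B a \<noteq> par B b \<longrightarrow> h t p a b = 0)"

text \<open>In a holomorphic frame the Chern connection is \<open>\<nabla>\<^sub>i = \<partial>\<^sub>i + \<Gamma>\<^sub>i\<close>, \<open>\<nabla>\<^bsub>\<bar>j\<^esub> = \<bar>\<partial>\<^sub>j\<close>, where \<open>\<Gamma>\<^sub>i\<close> acts on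
  columns, i.e. \<open>\<nabla>\<^sub>i e\<^sub>a = \<Sum>\<^sub>k (\<Gamma>\<^sub>i)\<^bsub>ka\<^esub> e\<^sub>k\<close>. As \<open>\<nabla>\<^bsub>\<bar>j\<^esub> e\<^sub>b = 0\<close>, compatibility with the metric reads
  \<open>\<partial>\<^sub>i h(e\<^sub>a, e\<^sub>b) = h(\<nabla>\<^sub>i e\<^sub>a, e\<^sub>b)\<close>, which determines \<open>\<Gamma>\<^sub>i\<close>.\<close>

definition chern_coeff ::
    "('x, 'e) gbundle \<Rightarrow> (('x, 'e) triv \<Rightarrow> 'x \<Rightarrow> nat \<Rightarrow> nat \<Rightarrow> complex) \<Rightarrow>
     ('x, 'd::finite) chart \<Rightarrow> ('x, 'e) triv \<Rightarrow> 'd \<Rightarrow> 'x \<Rightarrow> nat \<Rightarrow> nat \<Rightarrow> complex" where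
  "chern_coeff B h c t i p =
     (THE \<Gamma>. (\<forall>a b. a \<ge> rk B \<or> b \<ge> rk B \<longrightarrow> \<Gamma> a b = 0) \<and>
             (\<forall>a<rk B. \<forall>b<rk B.
                chart_d c i (\<lambda>q. h t q a b) p = (\<Sum>k<rk B. \<Gamma> k a * h t p k b)))"

text \<open>\<open>F\<^bsub>i\<bar>j\<^esub> = [\<nabla>\<^sub>i, \<nabla>\<^bsub>\<bar>j\<^esub>] = - \<bar>\<partial>\<^sub>j \<Gamma>\<^sub>i\<close>.\<close>

definition chern_curvature ::
    "('x, 'e) gbundle \<Rightarrow> (('x, 'e) triv \<Rightarrow> 'x \<Rightarrow> nat \<Rightarrow> nat \<Rightarrow> complex) \<Rightarrow>
     ('x, 'd::finite) chart \<Rightarrow> ('x, 'e) triv \<Rightarrow> 'd \<Rightarrow> 'd \<Rightarrow> 'x \<Rightarrow> nat \<Rightarrow> nat \<Rightarrow> complex" where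
  "chern_curvature B h c t i j p a b = - chart_dbar c j (\<lambda>q. chern_coeff B h c t i q a b) p"

text \<open>\<open>\<nabla>\<^sub>i D = \<partial>\<^sub>i D + [\<Gamma>\<^sub>i, D]\<close>, the induced connection on endomorphisms.\<close>

definition nabla_D ::
    "('x, 'e) gbundle \<Rightarrow> (('x, 'e) triv \<Rightarrow> 'x \<Rightarrow> nat \<Rightarrow> nat \<Rightarrow> complex) \<Rightarrow>
     (('x, 'e) triv \<Rightarrow> 'x \<Rightarrow> nat \<Rightarrow> nat \<Rightarrow> complex) \<Rightarrow>
     ('x, 'd::finite) chart \<Rightarrow> ('x, 'e) triv \<Rightarrow> 'd \<Rightarrow> 'x \<Rightarrow> nat \<Rightarrow> nat \<Rightarrow> complex" where
  "nabla_D B h D c t i p a b =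
     chart_d c i (\<lambda>q. D t q a b) p +
     (\<Sum>k<rk B. chern_coeff B h c t i p a k * D t p k b - D t p a k * chern_coeff B h c t i p k b)"


section \<open>Pointwise algebra of polyvector-valued forms\<close>

text \<open>In a chart, an element \<open>x\<close> of the fibre of \<open>PV(X)\<close> is the combination
  \<open>\<Sum> x J I d\<bar>z\<^sup>J \<otimes> \<partial>\<^sub>I\<close> of the increasing monomials. An element of the fibre of \<open>PV(X, End(E))\<close> has matrix
  coefficients with respect to a frame of \<open>E\<close>.\<close>

type_synonym 'd pv = "'d set \<Rightarrow> 'd set \<Rightarrow> complex"
type_synonym 'd pvend = "'d set \<Rightarrow> 'd set \<Rightarrow> nat \<Rightarrow> nat \<Rightarrow> complex"

text \<open>\<open>e\<^sub>A \<and> e\<^sub>B = wedge_sgn A B e\<^bsub>A \<union> B\<^esub>\<close> for disjoint \<open>A\<close>, \<open>B\<close>.\<close>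

definition wedge_sgn :: "'d::linorder set \<Rightarrow> 'd set \<Rightarrow> complex" where
  "wedge_sgn A B = (- 1) ^ card {(a, b). a \<in> A \<and> b \<in> B \<and> b < a}"

text \<open>The factor \<open>(-1)\<^bsup>|I1| |J - J1|\<^esup>\<close> is the sign \<open>(-1)\<^bsup>ij\<^esup>\<close> for the polyvector degree \<open>i\<close> of the first and
  form degree \<open>j\<close> of the second factor.\<close>

definition pv_mult :: "'d::{finite, linorder} pv \<Rightarrow> 'd pv \<Rightarrow> 'd pv" where
  "pv_mult x y = (\<lambda>J I. \<Sum>J1\<in>Pow J. \<Sum>I1\<in>Pow I.
     (- 1) ^ (card I1 * card (J - J1)) * wedge_sgn J1 (J - J1) * wedge_sgn I1 (I - I1)
       * x J1 I1 * y (J - J1) (I - I1))"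

text \<open>The additional sign is \<open>(-1)\<^bsup>\<sigma>(s) deg \<omega>\<^esup>\<close> for the matrix unit \<open>s = E\<^bsub>ak\<^esub>\<close> of the first and the total degree
  of the second factor.\<close>

definition end_mult ::
    "('x, 'e) gbundle \<Rightarrow> 'd::{finite, linorder} pvend \<Rightarrow> 'd pvend \<Rightarrow> 'd pvend" where
  "end_mult B x y = (\<lambda>J I a b. \<Sum>k<rk B. \<Sum>J1\<in>Pow J. \<Sum>I1\<in>Pow I.
     (- 1) ^ ((par B a + par B k) * (card (I - I1) + card (J - J1)))
       * (- 1) ^ (card I1 * card (J - J1)) * wedge_sgn J1 (J - J1) * wedge_sgn I1 (I - I1)
       * x J1 I1 a k * y (J - J1) (I - I1) k b)"

definition pv_one :: "'d pv" where
  "pv_one = (\<lambda>J I. if J = {} \<and> I = {} then 1 else 0)"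

definition pv_theta :: "'d \<Rightarrow> 'd pv" where
  "pv_theta i = (\<lambda>J I. if J = {} \<and> I = {i} then 1 else 0)"

definition pv_dzbar :: "'d \<Rightarrow> 'd pv" where
  "pv_dzbar j = (\<lambda>J I. if J = {j} \<and> I = {} then 1 else 0)"

text \<open>The inclusion \<open>\<omega> \<mapsto> \<omega> \<otimes> id\<^sub>E\<close>.\<close>

definition end_of_pv :: "'d pv \<Rightarrow> 'd pvend" where
  "end_of_pv x = (\<lambda>J I a b. if a = b then x J I else 0)"

definition end_one :: "'d pvend" where
  "end_one = end_of_pv pv_one"

text \<open>Exponentials \<open>e\<^bsup>sx\<^esup>\<close>, as power series taken componentwise.\<close>

definition pv_exp :: "real \<Rightarrow> 'd::{finite, linorder} pv \<Rightarrow> 'd pv" where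
  "pv_exp s x = (\<lambda>J I. \<Sum>n. complex_of_real (s ^ n / fact n) * (pv_mult x ^^ n) pv_one J I)"

definition end_exp :: "('x, 'e) gbundle \<Rightarrow> real \<Rightarrow> 'd::{finite, linorder} pvend \<Rightarrow> 'd pvend" where
  "end_exp B s x = (\<lambda>J I a b. \<Sum>n. complex_of_real (s ^ n / fact n) * (end_mult B x ^^ n) end_one J I a b)"

definition end_str :: "('x, 'e) gbundle \<Rightarrow> 'd pvend \<Rightarrow> 'd pv" where
  "end_str B x = (\<lambda>J I. \<Sum>a<rk B. (- 1) ^ par B a * x J I a a)"

text \<open>Reduced contraction with \<open>\<phi> dz\<^sup>1 \<and> \<dots> \<and> dz\<^sup>d\<close>. By definition it sends
  \<open>\<theta>\<^sub>1 \<cdots> \<theta>\<^sub>d \<cdot> d\<bar>z\<^sup>J = (-1)\<^bsup>d|J|\<^esup> d\<bar>z\<^sup>J \<otimes> (\<partial>\<^sub>1 \<and> \<dots> \<and> \<partial>\<^sub>d)\<close> to \<open>(-1)\<^bsup>d(d-1)/2\<^esup> \<phi> d\<bar>z\<^sup>J\<close>.\<close>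

definition contract_coeff :: "'d::finite set \<Rightarrow> complex" where
  "contract_coeff J = (- 1) ^ (CARD('d) * (CARD('d) - 1) div 2) * (- 1) ^ (CARD('d) * card J)"

definition pv_contract0 :: "complex \<Rightarrow> 'd::finite pv \<Rightarrow> 'd pv" where
  "pv_contract0 \<phi> x = (\<lambda>J I. if I = {} then \<phi> * contract_coeff J * x J UNIV else 0)"

definition end_contract0 :: "complex \<Rightarrow> 'd::finite pvend \<Rightarrow> 'd pvend" where
  "end_contract0 \<phi> x = (\<lambda>J I a b. if I = {} then \<phi> * contract_coeff J * x J UNIV a b else 0)"

text \<open>The algebra homomorphism \<open>d\<bar>z\<^sup>j \<mapsto> \<Sum>\<^sub>k B j k d\<bar>w\<^sup>k\<close>, \<open>\<partial>/\<partial>z\<^sup>i \<mapsto> \<Sum>\<^sub>k A k i \<partial>/\<partial>w\<^sup>k\<close>.\<close>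

definition pv_subst ::
    "('d \<Rightarrow> 'd \<Rightarrow> complex) \<Rightarrow> ('d \<Rightarrow> 'd \<Rightarrow> complex) \<Rightarrow> 'd::{finite, linorder} pv \<Rightarrow> 'd pv" where
  "pv_subst A B x = (\<lambda>J I. \<Sum>J0\<in>UNIV. \<Sum>I0\<in>UNIV. x J0 I0 *
     pv_mult
       (foldr (\<lambda>j. pv_mult (\<lambda>J' I'. \<Sum>k\<in>UNIV. B j k * pv_dzbar k J' I')) (sorted_list_of_set J0) pv_one)
       (foldr (\<lambda>i. pv_mult (\<lambda>J' I'. \<Sum>k\<in>UNIV. A k i * pv_theta k J' I')) (sorted_list_of_set I0) pv_one)
       J I)"

definition coord_change ::
    "('x, 'd) chart \<Rightarrow> ('x, 'd) chart \<Rightarrow> 'x \<Rightarrow> 'd::{finite, linorder} pv \<Rightarrow> 'd pv" where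
  "coord_change c c' p = pv_subst (jacobian c c' p) (\<lambda>j k. cnj (jacobian c' c p j k))"


section \<open>Global sections\<close>

text \<open>A section is the family of its local expressions; \<open>s c t p\<close> is the value at \<open>p\<close> written in the
  chart \<open>c\<close> and the frame \<open>t\<close>.\<close>

type_synonym ('x, 'd) pv_field = "('x, 'd) chart \<Rightarrow> 'x \<Rightarrow> 'd pv"
type_synonym ('x, 'd, 'e) end_field = "('x, 'd) chart \<Rightarrow> ('x, 'e) triv \<Rightarrow> 'x \<Rightarrow> 'd pvend"

definition PV :: "('x, 'd::{finite, linorder}) cmanifold \<Rightarrow> ('x, 'd) pv_field set" where
  "PV M = {\<omega>.
     (\<forall>c\<in>matlas M. \<forall>J I. smooth_fun M (fst c) (\<lambda>p. \<omega> c p J I)) \<and>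
     (\<forall>c\<in>matlas M. \<forall>c'\<in>matlas M. \<forall>p\<in>fst c \<inter> fst c'. \<omega> c' p = coord_change c c' p (\<omega> c p))}"

definition PV_c :: "('x, 'd::{finite, linorder}) cmanifold \<Rightarrow> ('x, 'd) pv_field set" where
  "PV_c M = {\<omega> \<in> PV M. \<exists>K. compactin (mtop M) K \<and>
     (\<forall>c\<in>matlas M. \<forall>p\<in>fst c - K. \<forall>J I. \<omega> c p J I = 0)}"

definition PV_End ::
    "('x, 'd::{finite, linorder}) cmanifold \<Rightarrow> ('x, 'e) gbundle \<Rightarrow> ('x, 'd, 'e) end_field set" where
  "PV_End M B = {s.
     (\<forall>c\<in>matlas M. \<forall>t\<in>trivs B. \<forall>J I. \<forall>a<rk B. \<forall>b<rk B.
        smooth_fun M (fst c \<inter> fst t) (\<lambda>p. s c t p J I a b)) \<and>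
     (\<forall>c\<in>matlas M. \<forall>c'\<in>matlas M. \<forall>t\<in>trivs B. \<forall>t'\<in>trivs B.
        \<forall>p\<in>fst c \<inter> fst c' \<inter> fst t \<inter> fst t'. \<forall>J I. \<forall>a<rk B. \<forall>b<rk B.
          (\<Sum>k<rk B. s c' t' p J I a k * transition B t t' p k b) =
          (\<Sum>k<rk B. transition B t t' p a k *
             coord_change c c' p (\<lambda>J' I'. s c t p J' I' k b) J I))}"

text \<open>\<open>End\<^bsub>DF_c(X,W)\<^esub>(a) = \<A>\<^sub>c(X, End(E))\<close>, the compactly supported sections of polyvector degree zero.\<close>

definition A_End_c ::
    "('x, 'd::{finite, linorder}) cmanifold \<Rightarrow> ('x, 'e) gbundle \<Rightarrow> ('x, 'd, 'e) end_field set" where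
  "A_End_c M B = {s \<in> PV_End M B.
     (\<forall>c\<in>matlas M. \<forall>t\<in>trivs B. \<forall>p\<in>fst c \<inter> fst t. \<forall>J I. \<forall>a<rk B. \<forall>b<rk B.
        I \<noteq> {} \<longrightarrow> s c t p J I a b = 0) \<and>
     (\<exists>K. compactin (mtop M) K \<and>
       (\<forall>c\<in>matlas M. \<forall>t\<in>trivs B. \<forall>p\<in>(fst c \<inter> fst t) - K. \<forall>J I. \<forall>a<rk B. \<forall>b<rk B.
          s c t p J I a b = 0))}"

definition PV_mult ::
    "('x, 'd::{finite, linorder}) pv_field \<Rightarrow> ('x, 'd) pv_field \<Rightarrow> ('x, 'd) pv_field" where
  "PV_mult x y = (\<lambda>c p. pv_mult (x c p) (y c p))"

definition PV_End_mult ::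
    "('x, 'e) gbundle \<Rightarrow> ('x, 'd::{finite, linorder}, 'e) end_field \<Rightarrow> ('x, 'd, 'e) end_field \<Rightarrow>
     ('x, 'd, 'e) end_field" where
  "PV_End_mult B x y = (\<lambda>c t p. end_mult B (x c t p) (y c t p))"

definition End_of_PV :: "('x, 'd) pv_field \<Rightarrow> ('x, 'd, 'e) end_field" where
  "End_of_PV \<omega> = (\<lambda>c t p. end_of_pv (\<omega> c p))"

definition contract0 ::
    "(('x, 'd) chart \<Rightarrow> 'x \<Rightarrow> complex) \<Rightarrow> ('x, 'd::finite) pv_field \<Rightarrow> ('x, 'd) pv_field" where
  "contract0 Om \<omega> = (\<lambda>c p. pv_contract0 (Om c p) (\<omega> c p))"

definition End_contract0 ::
    "(('x, 'd) chart \<Rightarrow> 'x \<Rightarrow> complex) \<Rightarrow> ('x, 'd::finite, 'e) end_field \<Rightarrow> ('x, 'd, 'e) end_field" where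
  "End_contract0 Om s = (\<lambda>c t p. end_contract0 (Om c p) (s c t p))"

text \<open>The supertrace does not depend on the frame, so it is computed in some frame at \<open>p\<close>.\<close>

definition supertrace ::
    "('x, 'e) gbundle \<Rightarrow> ('x, 'd, 'e) end_field \<Rightarrow> ('x, 'd) pv_field" where
  "supertrace B s = (\<lambda>c p. end_str B (s c (SOME t. t \<in> trivs B \<and> p \<in> fst t) p))"

definition lambda_Om ::
    "('x, 'e) gbundle \<Rightarrow> (('x, 'd) chart \<Rightarrow> 'x \<Rightarrow> complex) \<Rightarrow>
     ('x, 'd::finite, 'e) end_field \<Rightarrow> ('x, 'd) pv_field" where
  "lambda_Om B Om s = contract0 Om (supertrace B s)"


section \<open>Integration\<close>

text \<open>A (d,d)-form \<open>\<eta>\<close> is given by its coefficients with respect to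
  \<open>dz\<^sup>1 \<and> \<dots> \<and> dz\<^sup>d \<and> d\<bar>z\<^sup>1 \<and> \<dots> \<and> d\<bar>z\<^sup>d\<close>. This form equals \<open>(-1)\<^bsup>d(d-1)/2\<^esup> (-2\<i>)\<^sup>d\<close> times the form
  \<open>dx\<^sup>1 \<and> dy\<^sup>1 \<and> \<dots> \<and> dx\<^sup>d \<and> dy\<^sup>d\<close>, which is positive for the complex orientation.\<close>

definition chart_integral ::
    "('x, 'd::finite) chart \<Rightarrow> ('x \<Rightarrow> real) \<Rightarrow> (('x, 'd) chart \<Rightarrow> 'x \<Rightarrow> complex) \<Rightarrow> complex" where
  "chart_integral c \<rho> \<eta> = (- 1) ^ (CARD('d) * (CARD('d) - 1) div 2) * (- 2 * \<i>) ^ CARD('d) *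
     (LINT z : snd c ` fst c | lborel. complex_of_real (\<rho> (chart_inv c z)) * \<eta> c (chart_inv c z))"

text \<open>Finitely many smooth functions, compactly supported in charts and adding up to 1 on the support
  of \<open>\<eta>\<close>.\<close>

definition partition_for ::
    "('x, 'd::finite) cmanifold \<Rightarrow> (('x, 'd) chart \<Rightarrow> 'x \<Rightarrow> complex) \<Rightarrow>
     nat \<Rightarrow> (nat \<Rightarrow> ('x, 'd) chart) \<Rightarrow> (nat \<Rightarrow> 'x \<Rightarrow> real) \<Rightarrow> bool" where
  "partition_for M \<eta> n c \<rho> \<longleftrightarrow>
     (\<forall>k<n. c k \<in> matlas M \<and> smooth_fun M (topspace (mtop M)) (\<rho> k) \<and>
        (\<exists>K. compactin (mtop M) K \<and> K \<subseteq> fst (c k) \<and> (\<forall>p\<in>topspace (mtop M) - K. \<rho> k p = 0))) \<and>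
     (\<forall>c'\<in>matlas M. \<forall>p\<in>fst c'. \<eta> c' p \<noteq> 0 \<longrightarrow> (\<Sum>k<n. \<rho> k p) = 1)"

text \<open>For a smooth compactly supported form such partitions exist, and all of them give the same value.\<close>

definition form_integral ::
    "('x, 'd::finite) cmanifold \<Rightarrow> (('x, 'd) chart \<Rightarrow> 'x \<Rightarrow> complex) \<Rightarrow> complex" where
  "form_integral M \<eta> =
     (THE v. \<exists>n c \<rho>. partition_for M \<eta> n c \<rho> \<and> v = (\<Sum>k<n. chart_integral (c k) (\<rho> k) \<eta>))"

text \<open>The integral of \<open>\<Omega> \<and> \<beta>\<close> for \<open>\<beta> \<in> \<A>(X)\<close>.\<close>

definition integral_wedge ::
    "('x, 'd::finite) cmanifold \<Rightarrow> (('x, 'd) chart \<Rightarrow> 'x \<Rightarrow> complex) \<Rightarrow>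
     ('x, 'd) pv_field \<Rightarrow> complex" where
  "integral_wedge M Om \<beta> = form_integral M (\<lambda>c p. Om c p * \<beta> c p UNIV {})"


section \<open>Disk kernel and disk bulk-boundary maps\<close>

definition V_elem ::
    "('x, 'e) gbundle \<Rightarrow> (('x, 'd) chart \<Rightarrow> 'x \<Rightarrow> 'd \<Rightarrow> 'd \<Rightarrow> complex) \<Rightarrow>
     (('x, 'e) triv \<Rightarrow> 'x \<Rightarrow> nat \<Rightarrow> nat \<Rightarrow> complex) \<Rightarrow>
     (('x, 'e) triv \<Rightarrow> 'x \<Rightarrow> nat \<Rightarrow> nat \<Rightarrow> complex) \<Rightarrow>
     'd::finite \<Rightarrow> ('x, 'd, 'e) end_field" where
  "V_elem B G h D i = (\<lambda>c t p J I a b.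
     pv_one J I * nabla_D B h D c t i p a b +
     (\<Sum>j\<in>UNIV. pv_dzbar j J I *
        (chern_curvature B h c t i j p a b - \<i> * G c p i j * (if a = b then 1 else 0))))"

definition disk_kernel ::
    "(('x, 'd) chart \<Rightarrow> 'x \<Rightarrow> complex) \<Rightarrow> (('x, 'd) chart \<Rightarrow> 'x \<Rightarrow> 'd \<Rightarrow> 'd \<Rightarrow> complex) \<Rightarrow>
     ('x, 'e) gbundle \<Rightarrow>
     (('x, 'e) triv \<Rightarrow> 'x \<Rightarrow> nat \<Rightarrow> nat \<Rightarrow> complex) \<Rightarrow>
     (('x, 'e) triv \<Rightarrow> 'x \<Rightarrow> nat \<Rightarrow> nat \<Rightarrow> complex) \<Rightarrow>
     ('x, 'd::{finite, linorder}, 'e) end_field" where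
  "disk_kernel Om G B h D = (\<lambda>c t p J I a b.
     1 / (fact CARD('d) * Om c p) *
     (\<Sum>\<pi> | \<pi> permutes (UNIV :: 'd set). of_int (sign \<pi>) *
        foldr (\<lambda>k. end_mult B
            (\<lambda>J' I' a' b'. end_of_pv (pv_theta (\<pi> k)) J' I' a' b' +
                           \<i> * V_elem B G h D (\<pi> k) c t p J' I' a' b'))
          (sorted_list_of_set (UNIV :: 'd set)) end_one J I a b))"

definition e_B ::
    "(('x, 'd) chart \<Rightarrow> 'x \<Rightarrow> complex) \<Rightarrow> (('x, 'd) chart \<Rightarrow> 'x \<Rightarrow> 'd \<Rightarrow> 'd \<Rightarrow> complex) \<Rightarrow>
     ('x, 'e) gbundle \<Rightarrow>
     (('x, 'e) triv \<Rightarrow> 'x \<Rightarrow> nat \<Rightarrow> nat \<Rightarrow> complex) \<Rightarrow>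
     (('x, 'e) triv \<Rightarrow> 'x \<Rightarrow> nat \<Rightarrow> nat \<Rightarrow> complex) \<Rightarrow>
     ('x, 'd::{finite, linorder}) pv_field \<Rightarrow> ('x, 'd, 'e) end_field" where
  "e_B Om G B h D \<omega> = End_contract0 Om (PV_End_mult B (End_of_PV \<omega>) (disk_kernel Om G B h D))"

definition f_B ::
    "(('x, 'd) chart \<Rightarrow> 'x \<Rightarrow> complex) \<Rightarrow> (('x, 'd) chart \<Rightarrow> 'x \<Rightarrow> 'd \<Rightarrow> 'd \<Rightarrow> complex) \<Rightarrow>
     ('x, 'e) gbundle \<Rightarrow>
     (('x, 'e) triv \<Rightarrow> 'x \<Rightarrow> nat \<Rightarrow> nat \<Rightarrow> complex) \<Rightarrow>
     (('x, 'e) triv \<Rightarrow> 'x \<Rightarrow> nat \<Rightarrow> nat \<Rightarrow> complex) \<Rightarrow>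
     ('x, 'd::{finite, linorder}, 'e) end_field \<Rightarrow> ('x, 'd) pv_field" where
  "f_B Om G B h D \<alpha> = supertrace B (PV_End_mult B (disk_kernel Om G B h D) \<alpha>)"


section \<open>Tempered maps\<close>

text \<open>\<open>grad_G\<close> is the vector with components \<open>g\<^sup>i\<close> such that \<open>\<bar>\<partial>\<^sub>j \<bar>W = h\<^sub>G(g, \<partial>\<^sub>j)\<close> for all \<open>j\<close>.\<close>

definition grad_G ::
    "('x \<Rightarrow> complex) \<Rightarrow> (('x, 'd) chart \<Rightarrow> 'x \<Rightarrow> 'd \<Rightarrow> 'd \<Rightarrow> complex) \<Rightarrow>
     ('x, 'd::finite) chart \<Rightarrow> 'x \<Rightarrow> 'd \<Rightarrow> complex" where
  "grad_G W G c p =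
     (THE g. \<forall>j. chart_dbar c j (\<lambda>q. cnj (W q)) p = (\<Sum>i\<in>UNIV. g i * G c p i j))"

definition norm_dW_sq ::
    "('x \<Rightarrow> complex) \<Rightarrow> (('x, 'd) chart \<Rightarrow> 'x \<Rightarrow> 'd \<Rightarrow> 'd \<Rightarrow> complex) \<Rightarrow>
     ('x, 'd::finite) chart \<Rightarrow> 'x \<Rightarrow> complex" where
  "norm_dW_sq W G c p =
     (\<Sum>i\<in>UNIV. \<Sum>j\<in>UNIV. grad_G W G c p i * cnj (grad_G W G c p j) * G c p i j)"

text \<open>\<open>\<bar>\<partial>g\<^sup>i = \<Sum>\<^sub>k (\<bar>\<partial>\<^sub>k g\<^sup>i) d\<bar>z\<^sup>k\<close>, and \<open>H\<^sub>G = \<Sum>\<^sub>i \<bar>\<partial>g\<^sup>i \<otimes> \<partial>\<^sub>i\<close>.\<close>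

definition dbar_grad ::
    "('x \<Rightarrow> complex) \<Rightarrow> (('x, 'd) chart \<Rightarrow> 'x \<Rightarrow> 'd \<Rightarrow> 'd \<Rightarrow> complex) \<Rightarrow>
     'd::finite \<Rightarrow> ('x, 'd) pv_field" where
  "dbar_grad W G i = (\<lambda>c p J I.
     \<Sum>k\<in>UNIV. chart_dbar c k (\<lambda>q. grad_G W G c q i) p * pv_dzbar k J I)"

definition H_G ::
    "('x \<Rightarrow> complex) \<Rightarrow> (('x, 'd) chart \<Rightarrow> 'x \<Rightarrow> 'd \<Rightarrow> 'd \<Rightarrow> complex) \<Rightarrow>
     ('x, 'd::{finite, linorder}) pv_field" where
  "H_G W G = (\<lambda>c p J I. \<Sum>i\<in>UNIV. pv_mult (dbar_grad W G i c p) (pv_theta i) J I)"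

definition L_G ::
    "('x \<Rightarrow> complex) \<Rightarrow> (('x, 'd) chart \<Rightarrow> 'x \<Rightarrow> 'd \<Rightarrow> 'd \<Rightarrow> complex) \<Rightarrow>
     ('x, 'd::{finite, linorder}) pv_field" where
  "L_G W G = (\<lambda>c p J I. norm_dW_sq W G c p * pv_one J I + \<i> * H_G W G c p J I)"

definition N_a ::
    "('x \<Rightarrow> complex) \<Rightarrow> (('x, 'd) chart \<Rightarrow> 'x \<Rightarrow> 'd \<Rightarrow> 'd \<Rightarrow> complex) \<Rightarrow> ('x, 'e) gbundle \<Rightarrow>
     (('x, 'e) triv \<Rightarrow> 'x \<Rightarrow> nat \<Rightarrow> nat \<Rightarrow> complex) \<Rightarrow>
     (('x, 'e) triv \<Rightarrow> 'x \<Rightarrow> nat \<Rightarrow> nat \<Rightarrow> complex) \<Rightarrow>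
     ('x, 'd::{finite, linorder}, 'e) end_field" where
  "N_a W G B h D = (\<lambda>c t p J I a b. \<Sum>i\<in>UNIV.
     end_mult B (end_of_pv (dbar_grad W G i c p))
       (\<lambda>J' I' a' b'. pv_one J' I' * nabla_D B h D c t i p a' b' +
          (\<Sum>j\<in>UNIV. pv_dzbar j J' I' * chern_curvature B h c t i j p a' b'))
       J I a b)"

definition L_a ::
    "('x \<Rightarrow> complex) \<Rightarrow> (('x, 'd) chart \<Rightarrow> 'x \<Rightarrow> 'd \<Rightarrow> 'd \<Rightarrow> complex) \<Rightarrow> ('x, 'e) gbundle \<Rightarrow>
     (('x, 'e) triv \<Rightarrow> 'x \<Rightarrow> nat \<Rightarrow> nat \<Rightarrow> complex) \<Rightarrow>
     (('x, 'e) triv \<Rightarrow> 'x \<Rightarrow> nat \<Rightarrow> nat \<Rightarrow> complex) \<Rightarrow>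
     ('x, 'd::{finite, linorder}, 'e) end_field" where
  "L_a W G B h D = (\<lambda>c t p J I a b.
     norm_dW_sq W G c p * end_one J I a b + N_a W G B h D c t p J I a b)"

definition PV_exp :: "real \<Rightarrow> ('x, 'd::{finite, linorder}) pv_field \<Rightarrow> ('x, 'd) pv_field" where
  "PV_exp s x = (\<lambda>c p. pv_exp s (x c p))"

definition PV_End_exp ::
    "('x, 'e) gbundle \<Rightarrow> real \<Rightarrow> ('x, 'd::{finite, linorder}, 'e) end_field \<Rightarrow> ('x, 'd, 'e) end_field" where
  "PV_End_exp B s x = (\<lambda>c t p. end_exp B s (x c t p))"

definition Tr_temp ::
    "('x, 'd::{finite, linorder}) cmanifold \<Rightarrow> ('x \<Rightarrow> complex) \<Rightarrow>
     (('x, 'd) chart \<Rightarrow> 'x \<Rightarrow> complex) \<Rightarrow> (('x, 'd) chart \<Rightarrow> 'x \<Rightarrow> 'd \<Rightarrow> 'd \<Rightarrow> complex) \<Rightarrow>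
     real \<Rightarrow> ('x, 'd) pv_field \<Rightarrow> complex" where
  "Tr_temp M W Om G lam \<omega> =
     integral_wedge M Om (contract0 Om (PV_mult (PV_exp (- lam) (L_G W G)) \<omega>))"

definition tr_temp ::
    "('x, 'd::{finite, linorder}) cmanifold \<Rightarrow> ('x \<Rightarrow> complex) \<Rightarrow>
     (('x, 'd) chart \<Rightarrow> 'x \<Rightarrow> complex) \<Rightarrow> (('x, 'd) chart \<Rightarrow> 'x \<Rightarrow> 'd \<Rightarrow> 'd \<Rightarrow> complex) \<Rightarrow>
     ('x, 'e) gbundle \<Rightarrow>
     (('x, 'e) triv \<Rightarrow> 'x \<Rightarrow> nat \<Rightarrow> nat \<Rightarrow> complex) \<Rightarrow>
     (('x, 'e) triv \<Rightarrow> 'x \<Rightarrow> nat \<Rightarrow> nat \<Rightarrow> complex) \<Rightarrow>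
     real \<Rightarrow> ('x, 'd, 'e) end_field \<Rightarrow> complex" where
  "tr_temp M W Om G B h D lam \<alpha> =
     integral_wedge M Om (supertrace B (PV_End_mult B (PV_End_exp B (- lam) (L_a W G B h D)) \<alpha>))"

definition e_temp ::
    "('x \<Rightarrow> complex) \<Rightarrow>
     (('x, 'd) chart \<Rightarrow> 'x \<Rightarrow> complex) \<Rightarrow> (('x, 'd) chart \<Rightarrow> 'x \<Rightarrow> 'd \<Rightarrow> 'd \<Rightarrow> complex) \<Rightarrow>
     ('x, 'e) gbundle \<Rightarrow>
     (('x, 'e) triv \<Rightarrow> 'x \<Rightarrow> nat \<Rightarrow> nat \<Rightarrow> complex) \<Rightarrow>
     (('x, 'e) triv \<Rightarrow> 'x \<Rightarrow> nat \<Rightarrow> nat \<Rightarrow> complex) \<Rightarrow>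
     real \<Rightarrow> ('x, 'd::{finite, linorder}) pv_field \<Rightarrow> ('x, 'd, 'e) end_field" where
  "e_temp W Om G B h D lam \<omega> =
     PV_End_mult B (PV_End_exp B lam (L_a W G B h D))
       (e_B Om G B h D (PV_mult (PV_exp (- lam) (L_G W G)) \<omega>))"

end

theory Submission
  imports Defs
begin

text \<open>At a point of the manifold, written in a chart and a frame, all three integrands are elements of the
  same finite-dimensional algebra, so that the theorem reduces to an identity in
  \<open>\<and>(d\<bar>z) \<otimes> \<and>T \<otimes> End(E)\<close>. Put \<open>\<omega>' = e\<^bsup>-\<lambda>L\<^esup> \<omega>\<close> with \<open>L = L\<^sub>G\<close>, and write \<open>\<Pi>\<close> for the disk kernel.

  On the bulk side, \<open>str\<close> is linear over left multiplication by polyvector-valued forms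
  (\<open>end_str_end_of_pv_mult\<close>), so that \<open>\<omega>' str(\<Pi>\<alpha>) = str(\<omega>' \<Pi> \<alpha>)\<close> by associativity
  (\<open>end_mult_assoc\<close>). On the boundary side, associativity brings together the
  factors \<open>e\<^bsup>-\<lambda>x\<^esup>\<close> and \<open>e\<^bsup>\<lambda>x\<^esup>\<close> with \<open>x = L\<^sup>G\<^sub>a\<close>, and they cancel (\<open>end_exp_add\<close>). This leaves
  \<open>str(\<kappa>(\<omega>' \<Pi>) \<alpha>)\<close>, where \<open>\<kappa>\<close> is the reduced contraction with \<open>\<Omega>\<close>. As \<open>\<alpha>\<close> has polyvector degree zero,
  it cannot contribute to the component of top polyvector degree, which is the one that \<open>\<kappa>\<close> reads
  off; hence \<open>\<kappa>\<close> is linear over right multiplication by \<open>\<alpha>\<close> (\<open>end_contract0_mult_right\<close>), and the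
  boundary side becomes \<open>\<kappa>(str(\<omega>' \<Pi> \<alpha>))\<close> like the bulk side.

  The three integrals thus have the same integrand on every chart domain, and with it the same value
  (\<open>integral_wedge_cong\<close>).\<close>


section \<open>The signs of the wedge product\<close>

lemma wedge_sgn_eq_sum:
  fixes A B :: "'d::{finite, linorder} set"
  shows "wedge_sgn A B = (- 1) ^ (\<Sum>a\<in>A. card {b\<in>B. b < a})"
proof -
  have "{(a, b). a \<in> A \<and> b \<in> B \<and> b < a} = (SIGMA a:A. {b\<in>B. b < a})"
    by auto
  then show ?thesis
    by (simp add: wedge_sgn_def)
qed

lemma wedge_sgn_Un_left:
  fixes A B C :: "'d::{finite, linorder} set"
  assumes "A \<inter> B = {}"
  shows "wedge_sgn (A \<union> B) C = wedge_sgn A C * wedge_sgn B C"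
  using assms by (simp add: wedge_sgn_eq_sum sum.union_disjoint power_add)

lemma wedge_sgn_Un_right:
  fixes A B C :: "'d::{finite, linorder} set"
  assumes "B \<inter> C = {}"
  shows "wedge_sgn A (B \<union> C) = wedge_sgn A B * wedge_sgn A C"
proof -
  have "card {b \<in> B \<union> C. b < a} = card {b\<in>B. b < a} + card {b\<in>C. b < a}" for a
  proof -
    have "{b \<in> B \<union> C. b < a} = {b\<in>B. b < a} \<union> {b\<in>C. b < a}"
      by auto
    moreover have "{b\<in>B. b < a} \<inter> {b\<in>C. b < a} = {}"
      using assms by auto
    ultimately show ?thesis
      by (simp add: card_Un_disjoint)
  qed
  then show ?thesis
    by (simp add: wedge_sgn_eq_sum sum.distrib power_add)
qed

lemma wedge_sgn_empty [simp]: "wedge_sgn {} A = 1" "wedge_sgn A {} = 1"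
  by (simp_all add: wedge_sgn_def)

lemma norm_wedge_sgn [simp]: "norm (wedge_sgn A B) = 1"
  by (simp add: wedge_sgn_def norm_power)


section \<open>Associativity\<close>

text \<open>The structure constant of the algebra: for matrix units \<open>E\<^bsub>ak\<^esub>\<close> and disjoint index sets, it is the sign
  in front of \<open>d\<bar>z\<^bsup>J1 \<union> J2\<^esup> \<otimes> \<partial>\<^bsub>I1 \<union> I2\<^esub> \<otimes> E\<^bsub>ab\<^esub>\<close> in the product of \<open>d\<bar>z\<^bsup>J1\<^esup> \<otimes> \<partial>\<^bsub>I1\<^esub> \<otimes> E\<^bsub>ak\<^esub>\<close> and
  \<open>d\<bar>z\<^bsup>J2\<^esup> \<otimes> \<partial>\<^bsub>I2\<^esub> \<otimes> E\<^bsub>kb\<^esub>\<close>.\<close>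

definition end_sgn ::
    "('x, 'e) gbundle \<Rightarrow> nat \<Rightarrow> nat \<Rightarrow> 'd::{finite, linorder} set \<Rightarrow> 'd set \<Rightarrow> 'd set \<Rightarrow> 'd set \<Rightarrow> complex" where
  "end_sgn B a k J1 I1 J2 I2 =
     (- 1) ^ ((par B a + par B k) * (card I2 + card J2)) * (- 1) ^ (card I1 * card J2)
       * wedge_sgn J1 J2 * wedge_sgn I1 I2"

lemma end_mult_eq:
  "end_mult B x y J I a b = (\<Sum>k<rk B. \<Sum>J1\<in>Pow J. \<Sum>I1\<in>Pow I.
     end_sgn B a k J1 I1 (J - J1) (I - I1) * x J1 I1 a k * y (J - J1) (I - I1) k b)"
  by (simp add: end_mult_def end_sgn_def)

lemma norm_end_sgn [simp]: "norm (end_sgn B a k J1 I1 J2 I2) = 1"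
  by (simp add: end_sgn_def norm_mult norm_power)

lemma minus_one_power_add_even:
  "even (m + n) \<Longrightarrow> (- 1 :: complex) ^ m = (- 1) ^ n"
  by (metis even_add minus_one_power_iff)

text \<open>The cocycle condition behind associativity. The wedge signs are multiplicative in both arguments, and
  the parities of the inner matrix index \<open>k\<close> occur twice.\<close>

lemma end_sgn_cocycle:
  assumes "J1 \<inter> J2 = {}" "J1 \<inter> J3 = {}" "J2 \<inter> J3 = {}"
    and "I1 \<inter> I2 = {}" "I1 \<inter> I3 = {}" "I2 \<inter> I3 = {}"
  shows "end_sgn B a k J1 I1 (J2 \<union> J3) (I2 \<union> I3) * end_sgn B k l J2 I2 J3 I3 =
         end_sgn B a l (J1 \<union> J2) (I1 \<union> I2) J3 I3 * end_sgn B a k J1 I1 J2 I2"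
proof -
  define pa pk pl where p: "pa = par B a" "pk = par B k" "pl = par B l"
  define i1 i2 i3 where i: "i1 = card I1" "i2 = card I2" "i3 = card I3"
  define j1 j2 j3 where j: "j1 = card J1" "j2 = card J2" "j3 = card J3"
  have card: "card (J2 \<union> J3) = j2 + j3" "card (I2 \<union> I3) = i2 + i3" "card (I1 \<union> I2) = i1 + i2"
    using assms by (simp_all add: i j card_Un_disjoint)
  have wedge: "wedge_sgn J1 (J2 \<union> J3) * wedge_sgn J2 J3 = wedge_sgn (J1 \<union> J2) J3 * wedge_sgn J1 J2"
    "wedge_sgn I1 (I2 \<union> I3) * wedge_sgn I2 I3 = wedge_sgn (I1 \<union> I2) I3 * wedge_sgn I1 I2"
    using assms by (simp_all add: wedge_sgn_Un_left wedge_sgn_Un_right)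
  have "((pa + pk) * (i2 + i3 + (j2 + j3)) + i1 * (j2 + j3) + ((pk + pl) * (i3 + j3) + i2 * j3))
      + ((pa + pl) * (i3 + j3) + (i1 + i2) * j3 + ((pa + pk) * (i2 + j2) + i1 * j2))
      = 2 * ((pa + pk) * (i2 + j2) + (pa + pk + pl) * (i3 + j3) + i1 * j2 + i1 * j3 + i2 * j3)"
    by (simp add: algebra_simps)
  then have "even (((pa + pk) * (i2 + i3 + (j2 + j3)) + i1 * (j2 + j3) + ((pk + pl) * (i3 + j3) + i2 * j3))
      + ((pa + pl) * (i3 + j3) + (i1 + i2) * j3 + ((pa + pk) * (i2 + j2) + i1 * j2)))"
    by presburger
  from minus_one_power_add_even[OF this]
  have "(- 1 :: complex) ^ ((pa + pk) * (i2 + i3 + (j2 + j3))) * (- 1) ^ (i1 * (j2 + j3)) *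
        ((- 1) ^ ((pk + pl) * (i3 + j3)) * (- 1) ^ (i2 * j3)) =
        (- 1) ^ ((pa + pl) * (i3 + j3)) * (- 1) ^ ((i1 + i2) * j3) *
        ((- 1) ^ ((pa + pk) * (i2 + j2)) * (- 1) ^ (i1 * j2))" (is "?s = ?s'")
    by (simp only: power_add)
  moreover have "end_sgn B a k J1 I1 (J2 \<union> J3) (I2 \<union> I3) * end_sgn B k l J2 I2 J3 I3 = ?s *
      (wedge_sgn J1 (J2 \<union> J3) * wedge_sgn J2 J3) * (wedge_sgn I1 (I2 \<union> I3) * wedge_sgn I2 I3)"
    unfolding end_sgn_def card i[symmetric] j[symmetric] p[symmetric] by (simp only: mult_ac)
  moreover have "end_sgn B a l (J1 \<union> J2) (I1 \<union> I2) J3 I3 * end_sgn B a k J1 I1 J2 I2 = ?s' *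
      (wedge_sgn (J1 \<union> J2) J3 * wedge_sgn J1 J2) * (wedge_sgn (I1 \<union> I2) I3 * wedge_sgn I1 I2)"
    unfolding end_sgn_def card i[symmetric] j[symmetric] p[symmetric] by (simp only: mult_ac)
  ultimately show ?thesis
    by (simp only: wedge)
qed

text \<open>Both sides run over the ways to split \<open>J\<close> into three disjoint parts.\<close>

lemma sum_Pow_assoc:
  fixes f :: "'d::finite set \<Rightarrow> 'd set \<Rightarrow> 'd set \<Rightarrow> 'c::comm_monoid_add"
  shows "(\<Sum>A\<in>Pow J. \<Sum>A1\<in>Pow A. f A1 (A - A1) (J - A)) =
         (\<Sum>A1\<in>Pow J. \<Sum>A2\<in>Pow (J - A1). f A1 A2 (J - A1 - A2))"
proof -
  have "(\<Sum>(A, A1)\<in>Sigma (Pow J) Pow. f A1 (A - A1) (J - A)) =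
        (\<Sum>(A1, A2)\<in>(SIGMA A1:Pow J. Pow (J - A1)). f A1 A2 (J - A1 - A2))"
    by (rule sum.reindex_bij_witness
          [where i = "\<lambda>(A1, A2). (A1 \<union> A2, A1)" and j = "\<lambda>(A, A1). (A1, A - A1)"])
       (auto intro!: arg_cong3[where f = f])
  then show ?thesis
    by (simp add: sum.Sigma)
qed

text \<open>Brings the sums from the two nested products into the order in which the splittings of each index set
  stand next to each other, as \<open>sum_Pow_assoc\<close> needs them.\<close>

lemma sum_pull_out_index:
  fixes g :: "'k \<Rightarrow> 'a \<Rightarrow> 'a1 \<Rightarrow> 'c \<Rightarrow> 'c1 \<Rightarrow> 's::comm_monoid_add"
  shows "(\<Sum>a\<in>A. \<Sum>c\<in>C. \<Sum>k\<in>K. \<Sum>a1\<in>A1 a. \<Sum>c1\<in>C1 c. g k a a1 c c1) =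
         (\<Sum>k\<in>K. \<Sum>a\<in>A. \<Sum>a1\<in>A1 a. \<Sum>c\<in>C. \<Sum>c1\<in>C1 c. g k a a1 c c1)"
proof -
  have "(\<Sum>c\<in>C. \<Sum>k\<in>K. \<Sum>a1\<in>A1 a. \<Sum>c1\<in>C1 c. g k a a1 c c1) =
        (\<Sum>k\<in>K. \<Sum>a1\<in>A1 a. \<Sum>c\<in>C. \<Sum>c1\<in>C1 c. g k a a1 c c1)" for a
    by (subst sum.swap) (intro sum.cong refl sum.swap)
  then show ?thesis
    by (simp add: sum.swap[of _ K A])
qed

lemma end_mult_assoc:
  fixes x y z :: "'d::{finite, linorder} pvend"
  shows "end_mult B (end_mult B x y) z = end_mult B x (end_mult B y z)"
proof (intro ext)
  fix J I :: "'d set" and a b :: nat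
  let ?f = "\<lambda>k l J1 J2 J3 I1 I2 I3.
    end_sgn B a l (J1 \<union> J2) (I1 \<union> I2) J3 I3 * end_sgn B a k J1 I1 J2 I2
      * x J1 I1 a k * y J2 I2 k l * z J3 I3 l b"
  let ?g = "\<lambda>k l J1 J2 J3 I1 I2 I3.
    end_sgn B a k J1 I1 (J2 \<union> J3) (I2 \<union> I3) * end_sgn B k l J2 I2 J3 I3
      * x J1 I1 a k * y J2 I2 k l * z J3 I3 l b"
  have "end_mult B (end_mult B x y) z J I a b =
      (\<Sum>l<rk B. \<Sum>A\<in>Pow J. \<Sum>C\<in>Pow I. \<Sum>k<rk B. \<Sum>A1\<in>Pow A. \<Sum>C1\<in>Pow C.
         ?f k l A1 (A - A1) (J - A) C1 (C - C1) (I - C))"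
    unfolding end_mult_eq sum_distrib_left sum_distrib_right
    by (intro sum.cong refl) (auto simp: Un_absorb1 mult_ac)
  also have "\<dots> = (\<Sum>l<rk B. \<Sum>k<rk B. \<Sum>A\<in>Pow J. \<Sum>A1\<in>Pow A. \<Sum>C\<in>Pow I. \<Sum>C1\<in>Pow C.
         ?f k l A1 (A - A1) (J - A) C1 (C - C1) (I - C))"
    by (intro sum.cong refl sum_pull_out_index)
  also have "\<dots> = (\<Sum>l<rk B. \<Sum>k<rk B. \<Sum>A1\<in>Pow J. \<Sum>A2\<in>Pow (J - A1). \<Sum>C1\<in>Pow I. \<Sum>C2\<in>Pow (I - C1).
         ?f k l A1 A2 (J - A1 - A2) C1 C2 (I - C1 - C2))"
    by (rule sum.cong[OF refl], rule sum.cong[OF refl],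
        rule trans[OF sum_Pow_assoc
          [where f = "\<lambda>A1 A2 A3. \<Sum>C\<in>Pow I. \<Sum>C1\<in>Pow C. ?f k l A1 A2 A3 C1 (C - C1) (I - C)" for k l]],
        rule sum.cong[OF refl], rule sum.cong[OF refl],
        rule sum_Pow_assoc[where f = "?f k l A1 A2 A3" for k l A1 A2 A3])
  also have "\<dots> = (\<Sum>l<rk B. \<Sum>k<rk B. \<Sum>A1\<in>Pow J. \<Sum>A2\<in>Pow (J - A1). \<Sum>C1\<in>Pow I. \<Sum>C2\<in>Pow (I - C1).
         ?g k l A1 A2 (J - A1 - A2) C1 C2 (I - C1 - C2))"
    by (intro sum.cong refl arg_cong2[where f = "(*)"] end_sgn_cocycle[symmetric]) auto
  also have "\<dots> = (\<Sum>k<rk B. \<Sum>l<rk B. \<Sum>A1\<in>Pow J. \<Sum>A2\<in>Pow (J - A1). \<Sum>C1\<in>Pow I. \<Sum>C2\<in>Pow (I - C1).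
         ?g k l A1 A2 (J - A1 - A2) C1 C2 (I - C1 - C2))"
    by (rule sum.swap)
  also have "\<dots> = (\<Sum>k<rk B. \<Sum>A1\<in>Pow J. \<Sum>C1\<in>Pow I. \<Sum>l<rk B. \<Sum>A2\<in>Pow (J - A1). \<Sum>C2\<in>Pow (I - C1).
         ?g k l A1 A2 (J - A1 - A2) C1 C2 (I - C1 - C2))"
    by (intro sum.cong refl sum_pull_out_index[symmetric])
  also have "\<dots> = end_mult B x (end_mult B y z) J I a b"
    unfolding end_mult_eq sum_distrib_left sum_distrib_right
    by (intro sum.cong refl) (auto simp: Un_Diff_cancel Un_absorb1 mult_ac)
  finally show "end_mult B (end_mult B x y) z J I a b = end_mult B x (end_mult B y z) J I a b" .
qed

lemma end_mult_cong:
  assumes "\<And>J I k. k < rk B \<Longrightarrow> x J I a k = x' J I a k"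
    and "\<And>J I k. k < rk B \<Longrightarrow> y J I k b = y' J I k b"
  shows "end_mult B x y J I a b = end_mult B x' y' J I a b"
  using assms by (simp add: end_mult_def)


section \<open>Polyvector-valued forms acting from the left\<close>

text \<open>A multiple of the identity has bundle degree zero and therefore picks up no sign.\<close>

lemma end_mult_end_of_pv:
  assumes "a < rk B"
  shows "end_mult B (end_of_pv x) y J I a b = pv_mult x (\<lambda>J I. y J I a b) J I"
proof -
  have "end_mult B (end_of_pv x) y J I a b =
      (\<Sum>k<rk B. if k = a then pv_mult x (\<lambda>J I. y J I a b) J I else 0)"
    unfolding end_mult_def by (intro sum.cong refl) (simp add: end_of_pv_def pv_mult_def)
  then show ?thesis
    using assms by simp
qed

lemma pv_mult_zero_right: "pv_mult x (\<lambda>J I. 0) J I = 0"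
  by (simp add: pv_mult_def)

lemma end_mult_end_of_pv_end_of_pv:
  assumes "a < rk B"
  shows "end_mult B (end_of_pv x) (end_of_pv y) J I a b = end_of_pv (pv_mult x y) J I a b"
  using assms by (simp add: end_mult_end_of_pv) (simp add: end_of_pv_def pv_mult_zero_right)

lemma pv_mult_one_left: "pv_mult pv_one x J I = x J I"
proof -
  have "pv_mult pv_one x J I = (\<Sum>J1\<in>Pow J. \<Sum>I1\<in>Pow I. if I1 = {} then if J1 = {} then x J I else 0 else 0)"
    unfolding pv_mult_def by (intro sum.cong refl) (auto simp: pv_one_def)
  then show ?thesis
    by simp
qed

lemma end_mult_one_left:
  "a < rk B \<Longrightarrow> end_mult B end_one x J I a b = x J I a b"
  by (simp add: end_one_def end_mult_end_of_pv pv_mult_one_left)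

lemma end_str_end_of_pv_mult: "end_str B (end_mult B (end_of_pv x) y) = pv_mult x (end_str B y)"
proof (intro ext)
  fix J I
  have "end_str B (end_mult B (end_of_pv x) y) J I =
      (\<Sum>a<rk B. \<Sum>J1\<in>Pow J. \<Sum>I1\<in>Pow I. (- 1) ^ par B a *
        ((- 1) ^ (card I1 * card (J - J1)) * wedge_sgn J1 (J - J1) * wedge_sgn I1 (I - I1)
          * x J1 I1 * y (J - J1) (I - I1) a a))"
    by (simp add: end_str_def end_mult_end_of_pv pv_mult_def sum_distrib_left)
  also have "\<dots> = (\<Sum>J1\<in>Pow J. \<Sum>I1\<in>Pow I. \<Sum>a<rk B. (- 1) ^ par B a *
        ((- 1) ^ (card I1 * card (J - J1)) * wedge_sgn J1 (J - J1) * wedge_sgn I1 (I - I1)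
          * x J1 I1 * y (J - J1) (I - I1) a a))"
    by (subst sum.swap, intro sum.cong refl) (rule sum.swap)
  also have "\<dots> = pv_mult x (end_str B y) J I"
    by (simp add: pv_mult_def end_str_def sum_distrib_left mult_ac)
  finally show "end_str B (end_mult B (end_of_pv x) y) J I = pv_mult x (end_str B y) J I" .
qed

lemma end_str_cong:
  assumes "\<And>J I a. a < rk B \<Longrightarrow> x J I a a = y J I a a"
  shows "end_str B x = end_str B y"
  using assms by (simp add: end_str_def fun_eq_iff)


section \<open>Linearity of the reduced contraction\<close>

text \<open>If \<open>y\<close> has polyvector degree zero, then \<open>xy\<close> has a component of top polyvector degree only through
  that of \<open>x\<close>. The sign \<open>(-1)\<^bsup>d j\<^esup>\<close> from moving a form of degree \<open>j\<close> past \<open>\<partial>\<^sub>1 \<and> \<dots> \<and> \<partial>\<^sub>d\<close> is the factor by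
  which the contraction coefficients of the product and of \<open>x\<close> differ.\<close>

lemma end_contract0_mult_right:
  fixes x y :: "'d::{finite, linorder} pvend"
  assumes y: "\<And>J I k. k < rk B \<Longrightarrow> I \<noteq> {} \<Longrightarrow> y J I k b = 0"
  shows "end_contract0 \<phi> (end_mult B x y) J I a b = end_mult B (end_contract0 \<phi> x) y J I a b"
proof (cases "I = {}")
  case False
  have "end_mult B (end_contract0 \<phi> x) y J I a b = (\<Sum>k<rk B. \<Sum>J1\<in>Pow J. \<Sum>I1\<in>Pow I. 0)"
    unfolding end_mult_eq
  proof (intro sum.cong refl)
    fix k J1 I1 assume "k \<in> {..<rk B}" "I1 \<in> Pow I"
    then show "end_sgn B a k J1 I1 (J - J1) (I - I1) * end_contract0 \<phi> x J1 I1 a k * y (J - J1) (I - I1) k b = 0"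
      using False by (cases "I1 = {}") (auto simp: end_contract0_def y)
  qed
  with False show ?thesis
    by (simp add: end_contract0_def)
next
  case True
  have sign: "contract_coeff J * end_sgn B a k J1 UNIV (J - J1) {} =
      end_sgn B a k J1 {} (J - J1) {} * contract_coeff J1" if "J1 \<subseteq> J" for J1 k
  proof -
    have "card J = card J1 + card (J - J1)"
      using that by (metis card_Diff_subset card_mono finite le_add_diff_inverse)
    then have "(- 1 :: complex) ^ (CARD('d) * card J) * (- 1) ^ (CARD('d) * card (J - J1)) =
        (- 1) ^ (CARD('d) * card J1)"
      by (simp add: distrib_left power_add mult.assoc flip: power_mult_distrib)
    then show ?thesis
      by (simp add: contract_coeff_def end_sgn_def mult_ac)
  qed
  have "(\<Sum>I1\<in>UNIV. end_sgn B a k J1 I1 (J - J1) (UNIV - I1) * x J1 I1 a k * y (J - J1) (UNIV - I1) k b) =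
      (\<Sum>I1\<in>{UNIV}. end_sgn B a k J1 I1 (J - J1) (UNIV - I1) * x J1 I1 a k * y (J - J1) (UNIV - I1) k b)"
    if "k < rk B" for k J1
    \<comment> \<open>Any proper subset \<open>I1\<close> leaves a positive polyvector degree to \<open>y\<close>.\<close>
  proof (rule sum.mono_neutral_right)
    show "\<forall>I1\<in>UNIV - {UNIV}. end_sgn B a k J1 I1 (J - J1) (UNIV - I1) * x J1 I1 a k *
        y (J - J1) (UNIV - I1) k b = 0"
      using y[OF that] by (simp add: Diff_eq_empty_iff top_unique)
  qed auto
  then have "end_contract0 \<phi> (end_mult B x y) J I a b =
      (\<Sum>k<rk B. \<Sum>J1\<in>Pow J. \<phi> * contract_coeff J *
         (end_sgn B a k J1 UNIV (J - J1) {} * x J1 UNIV a k * y (J - J1) {} k b))"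
    using True by (simp add: end_contract0_def end_mult_eq) (simp add: sum_distrib_left mult_ac)
  also have "\<dots> = (\<Sum>k<rk B. \<Sum>J1\<in>Pow J.
         end_sgn B a k J1 {} (J - J1) {} * (\<phi> * contract_coeff J1 * x J1 UNIV a k) * y (J - J1) {} k b)"
  proof (intro sum.cong refl)
    fix k J1 assume "J1 \<in> Pow J"
    then show "\<phi> * contract_coeff J *
         (end_sgn B a k J1 UNIV (J - J1) {} * x J1 UNIV a k * y (J - J1) {} k b) =
         end_sgn B a k J1 {} (J - J1) {} * (\<phi> * contract_coeff J1 * x J1 UNIV a k) * y (J - J1) {} k b"
      using sign[of J1 k] by (simp add: algebra_simps)
  qed
  also have "\<dots> = end_mult B (end_contract0 \<phi> x) y J I a b"
    using True by (simp add: end_mult_eq end_contract0_def)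
  finally show ?thesis .
qed

lemma end_str_end_contract0: "end_str B (end_contract0 \<phi> x) = pv_contract0 \<phi> (end_str B x)"
  by (simp add: fun_eq_iff end_str_def end_contract0_def pv_contract0_def sum_distrib_left mult_ac)


section \<open>Exponentials\<close>

abbreviation end_power ::
    "('x, 'e) gbundle \<Rightarrow> 'd::{finite, linorder} pvend \<Rightarrow> nat \<Rightarrow> 'd pvend" where
  "end_power B x n \<equiv> (end_mult B x ^^ n) end_one"

lemma end_power_add:
  assumes "a < rk B"
  shows "end_mult B (end_power B x m) (end_power B x n) J I a b = end_power B x (m + n) J I a b"
  using assms
proof (induction m arbitrary: J I a)
  case 0
  then show ?case
    by (simp add: end_mult_one_left)
next
  case (Suc m)
  then show ?case
    by (simp add: end_mult_assoc) (rule end_mult_cong; simp)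
qed

text \<open>All structure constants are signs. Hence the sum of the norms of all entries of \<open>x\<close> bounds left
  multiplication by \<open>x\<close> with respect to the maximum of the norms of the entries. Absolute convergence
  of the exponential series follows by comparison with the exponential series of a real number.\<close>

lemma norm_end_power_le:
  fixes x :: "'d::{finite, linorder} pvend"
  shows "\<exists>C. \<forall>n J I a b. a < rk B \<longrightarrow> norm (end_power B x n J I a b) \<le> C ^ n"
proof -
  define S where "S a = (\<Sum>k<rk B. \<Sum>J\<in>UNIV. \<Sum>I\<in>UNIV. norm (x J I a k))" for a
  define C where "C = (\<Sum>a<rk B. S a)"
  have S: "S a \<ge> 0" for a
    unfolding S_def by (intro sum_nonneg norm_ge_zero)
  then have "C \<ge> 0"
    unfolding C_def by (intro sum_nonneg)
  moreover have "norm (end_power B x n J I a b) \<le> C ^ n" if "a < rk B" for n J I a b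
    using that
  proof (induction n arbitrary: J I a)
    case 0
    then show ?case
      by (simp add: end_one_def end_of_pv_def pv_one_def)
  next
    case (Suc n)
    let ?p = "end_power B x n"
    have "norm (end_mult B x ?p J I a b) \<le> (\<Sum>k<rk B. \<Sum>J1\<in>Pow J. \<Sum>I1\<in>Pow I.
        norm (end_sgn B a k J1 I1 (J - J1) (I - I1) * x J1 I1 a k * ?p (J - J1) (I - I1) k b))"
      unfolding end_mult_eq by (intro order_trans[OF norm_sum] sum_mono order_refl)
    also have "\<dots> \<le> (\<Sum>k<rk B. \<Sum>J1\<in>Pow J. \<Sum>I1\<in>Pow I. norm (x J1 I1 a k) * C ^ n)"
      using Suc.IH by (intro sum_mono) (auto simp: norm_mult intro!: mult_left_mono)
    also have "\<dots> \<le> (\<Sum>k<rk B. \<Sum>J1\<in>UNIV. \<Sum>I1\<in>UNIV. norm (x J1 I1 a k) * C ^ n)"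
    proof (rule sum_mono)
      fix k
      have "(\<Sum>J1\<in>Pow J. \<Sum>I1\<in>Pow I. norm (x J1 I1 a k) * C ^ n) \<le>
          (\<Sum>J1\<in>Pow J. \<Sum>I1\<in>UNIV. norm (x J1 I1 a k) * C ^ n)"
        using \<open>C \<ge> 0\<close> by (intro sum_mono sum_mono2) auto
      also have "\<dots> \<le> (\<Sum>J1\<in>UNIV. \<Sum>I1\<in>UNIV. norm (x J1 I1 a k) * C ^ n)"
        using \<open>C \<ge> 0\<close> by (intro sum_mono2) (auto intro!: sum_nonneg)
      finally show "(\<Sum>J1\<in>Pow J. \<Sum>I1\<in>Pow I. norm (x J1 I1 a k) * C ^ n) \<le>
          (\<Sum>J1\<in>UNIV. \<Sum>I1\<in>UNIV. norm (x J1 I1 a k) * C ^ n)" .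
    qed
    also have "\<dots> = S a * C ^ n"
      by (simp add: S_def sum_distrib_right)
    also have "S a \<le> C"
      unfolding C_def using Suc.prems S by (intro member_le_sum) auto
    then have "S a * C ^ n \<le> C * C ^ n"
      using \<open>C \<ge> 0\<close> by (intro mult_right_mono) auto
    finally show ?case
      by simp
  qed
  ultimately show ?thesis
    by blast
qed

lemma summable_norm_end_exp:
  assumes "a < rk B"
  shows "summable (\<lambda>n. norm (complex_of_real (s ^ n / fact n) * end_power B x n J I a b))"
proof -
  obtain C where C: "\<And>n J I a b. a < rk B \<Longrightarrow> norm (end_power B x n J I a b) \<le> C ^ n"
    using norm_end_power_le[of B x] by metis
  show ?thesis
  proof (rule summable_comparison_test')
    show "summable (\<lambda>n. (\<bar>s\<bar> * C) ^ n /\<^sub>R fact n)"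
      by (rule summable_exp_generic)
    show "norm (norm (complex_of_real (s ^ n / fact n) * end_power B x n J I a b)) \<le>
        (\<bar>s\<bar> * C) ^ n /\<^sub>R fact n" for n
    proof -
      have "\<bar>s\<bar> ^ n / fact n * norm (end_power B x n J I a b) \<le> \<bar>s\<bar> ^ n / fact n * C ^ n"
        using assms by (intro mult_left_mono C) auto
      also have "\<dots> = (\<bar>s\<bar> * C) ^ n /\<^sub>R fact n"
        by (simp add: power_mult_distrib divide_inverse mult_ac)
      finally show ?thesis
        by (simp add: norm_mult norm_divide norm_power)
    qed
  qed
qed

text \<open>An entry of the product is a finite combination of products of two absolutely convergent series, so
  it is the sum of their Cauchy products. The powers of one element satisfy \<open>x\<^sup>i x\<^bsup>n-i\<^esup> = x\<^sup>n\<close>, and the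
  binomial theorem collects the coefficients.\<close>

lemma end_exp_add:
  fixes x :: "'d::{finite, linorder} pvend"
  assumes a: "a < rk B"
  shows "end_mult B (end_exp B s x) (end_exp B t x) J I a b = end_exp B (s + t) x J I a b"
proof -
  define P where "P = end_power B x"
  define u where "u r n = complex_of_real (r ^ n / fact n)" for r n
  have exp: "end_exp B r x J I a b = (\<Sum>n. u r n * P n J I a b)" for r J I a b
    by (simp add: end_exp_def P_def u_def)
  have summable: "summable (\<lambda>n. norm (u r n * P n J I a b))" if "a < rk B" for r J I a b
    using summable_norm_end_exp[OF that] by (simp add: P_def u_def)
  have binomial: "(\<Sum>i\<le>n. u s i * u t (n - i)) = u (s + t) n" for n
  proof -
    have "(s + t) ^ n /\<^sub>R fact n = (\<Sum>i\<le>n. (s ^ i /\<^sub>R fact i) * (t ^ (n - i) /\<^sub>R fact (n - i)))"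
      by (rule exp_series_add_commuting) (rule mult.commute)
    then have "(s + t) ^ n / fact n = (\<Sum>i\<le>n. (s ^ i / fact i) * (t ^ (n - i) / fact (n - i)))"
      by (simp add: divide_inverse mult_ac)
    then show ?thesis
      by (simp only: u_def flip: of_real_mult of_real_sum)
  qed
  let ?e = "\<lambda>k J1 I1. end_sgn B a k J1 I1 (J - J1) (I - I1)"
  have cauchy: "(\<lambda>n. \<Sum>k<rk B. \<Sum>J1\<in>Pow J. \<Sum>I1\<in>Pow I. ?e k J1 I1 *
      (\<Sum>i\<le>n. (u s i * P i J1 I1 a k) * (u t (n - i) * P (n - i) (J - J1) (I - I1) k b)))
    sums end_mult B (end_exp B s x) (end_exp B t x) J I a b"
    unfolding end_mult_eq exp mult.assoc[of "end_sgn _ _ _ _ _ _ _"]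
    by (intro sums_sum sums_mult Cauchy_product_sums summable) (use a in auto)
  have "(\<Sum>k<rk B. \<Sum>J1\<in>Pow J. \<Sum>I1\<in>Pow I. ?e k J1 I1 *
      (\<Sum>i\<le>n. (u s i * P i J1 I1 a k) * (u t (n - i) * P (n - i) (J - J1) (I - I1) k b)))
    = u (s + t) n * P n J I a b" for n
  proof -
    have "(\<Sum>k<rk B. \<Sum>J1\<in>Pow J. \<Sum>I1\<in>Pow I. ?e k J1 I1 *
        (\<Sum>i\<le>n. (u s i * P i J1 I1 a k) * (u t (n - i) * P (n - i) (J - J1) (I - I1) k b)))
      = (\<Sum>k<rk B. \<Sum>J1\<in>Pow J. \<Sum>I1\<in>Pow I. \<Sum>i\<le>n. u s i * u t (n - i) *
          (?e k J1 I1 * P i J1 I1 a k * P (n - i) (J - J1) (I - I1) k b))"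
      by (simp add: sum_distrib_left mult_ac)
    also have "\<dots> = (\<Sum>i\<le>n. \<Sum>k<rk B. \<Sum>J1\<in>Pow J. \<Sum>I1\<in>Pow I. u s i * u t (n - i) *
          (?e k J1 I1 * P i J1 I1 a k * P (n - i) (J - J1) (I - I1) k b))"
      by (simp only: sum.swap[of _ "{..n}"])
    also have "\<dots> = (\<Sum>i\<le>n. u s i * u t (n - i) * end_mult B (P i) (P (n - i)) J I a b)"
      by (simp only: end_mult_eq sum_distrib_left)
    also have "\<dots> = (\<Sum>i\<le>n. u s i * u t (n - i) * P n J I a b)"
      using a by (simp add: P_def end_power_add)
    finally show ?thesis
      by (simp add: binomial flip: sum_distrib_right)
  qed
  with cauchy have "(\<lambda>n. u (s + t) n * P n J I a b) sums
      end_mult B (end_exp B s x) (end_exp B t x) J I a b"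
    by simp
  then show ?thesis
    unfolding exp by (rule sums_unique)
qed

lemma end_exp_0: "end_exp B 0 x = end_one"
proof (intro ext)
  fix J I a b
  have "end_exp B 0 x J I a b =
      (\<Sum>n\<in>{0}. complex_of_real (0 ^ n / fact n) * end_power B x n J I a b)"
    unfolding end_exp_def by (rule suminf_finite) auto
  then show "end_exp B 0 x J I a b = end_one J I a b"
    by simp
qed

lemma end_exp_cancel:
  assumes "a < rk B"
  shows "end_mult B (end_exp B (- s) x) (end_mult B (end_exp B s x) y) J I a b = y J I a b"
proof -
  have "end_mult B (end_exp B (- s) x) (end_mult B (end_exp B s x) y) J I a b =
      end_mult B end_one y J I a b"
    unfolding end_mult_assoc[symmetric]
    by (rule end_mult_cong) (use assms in \<open>simp_all add: end_exp_add end_exp_0\<close>)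
  with assms show ?thesis
    by (simp add: end_mult_one_left)
qed


section \<open>The pointwise identities\<close>

text \<open>Moving \<open>w\<close> and \<open>x\<close> through the supertrace one after the other leaves all regrouping to the
  associativity of the endomorphism-valued product.\<close>

lemma bulk_integrand:
  "pv_mult x (pv_mult w (end_str B (end_mult B P z))) =
     end_str B (end_mult B (end_mult B (end_of_pv (pv_mult x w)) P) z)"
proof -
  have "pv_mult x (pv_mult w (end_str B (end_mult B P z))) =
      end_str B (end_mult B (end_mult B (end_mult B (end_of_pv x) (end_of_pv w)) P) z)"
    by (simp add: end_str_end_of_pv_mult end_mult_assoc)
  also have "\<dots> = end_str B (end_mult B (end_mult B (end_of_pv (pv_mult x w)) P) z)"
    by (intro end_str_cong end_mult_cong) (auto simp: end_mult_end_of_pv_end_of_pv)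
  finally show ?thesis .
qed

lemma boundary_integrand:
  assumes "\<And>J I a b. a < rk B \<Longrightarrow> b < rk B \<Longrightarrow> I \<noteq> {} \<Longrightarrow> z J I a b = 0"
  shows "end_str B (end_mult B (end_exp B (- s) x)
           (end_mult B (end_mult B (end_exp B s x) (end_contract0 \<phi> y)) z)) =
         pv_contract0 \<phi> (end_str B (end_mult B y z))"
proof -
  have "end_str B (end_mult B (end_exp B (- s) x)
           (end_mult B (end_mult B (end_exp B s x) (end_contract0 \<phi> y)) z)) =
      end_str B (end_mult B (end_contract0 \<phi> y) z)"
    by (rule end_str_cong) (simp add: end_mult_assoc end_exp_cancel)
  also have "\<dots> = end_str B (end_contract0 \<phi> (end_mult B y z))"
    using assms by (intro end_str_cong end_contract0_mult_right[symmetric])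
  finally show ?thesis
    by (simp add: end_str_end_contract0)
qed


section \<open>Integration\<close>

lemma chart_integral_cong:
  assumes "\<And>p. p \<in> fst c \<Longrightarrow> \<eta> c p = \<eta>' c p"
  shows "chart_integral c \<rho> \<eta> = chart_integral c \<rho> \<eta>'"
proof -
  have "(LINT z : snd c ` fst c | lborel. complex_of_real (\<rho> (chart_inv c z)) * \<eta> c (chart_inv c z)) =
        (LINT z : snd c ` fst c | lborel. complex_of_real (\<rho> (chart_inv c z)) * \<eta>' c (chart_inv c z))"
    unfolding set_lebesgue_integral_def
    by (rule Bochner_Integration.integral_cong) (auto simp: indicator_def assms inv_into_into)
  then show ?thesis
    by (simp add: chart_integral_def)
qed

text \<open>A partition of unity and its chart integrals see a form only on the chart domains.\<close>

lemma form_integral_cong: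
  assumes eq: "\<And>c p. c \<in> matlas M \<Longrightarrow> p \<in> fst c \<Longrightarrow> \<eta> c p = \<eta>' c p"
  shows "form_integral M \<eta> = form_integral M \<eta>'"
proof -
  have "partition_for M \<eta> n c \<rho> \<longleftrightarrow> partition_for M \<eta>' n c \<rho>" for n c \<rho>
    by (simp add: partition_for_def eq)
  moreover have "(\<Sum>k<n. chart_integral (c k) (\<rho> k) \<eta>) = (\<Sum>k<n. chart_integral (c k) (\<rho> k) \<eta>')"
    if "partition_for M \<eta>' n c \<rho>" for n c \<rho>
    using that by (intro sum.cong refl chart_integral_cong) (auto simp: partition_for_def eq)
  ultimately have "(\<exists>n c \<rho>. partition_for M \<eta> n c \<rho> \<and> v = (\<Sum>k<n. chart_integral (c k) (\<rho> k) \<eta>)) \<longleftrightarrow>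
      (\<exists>n c \<rho>. partition_for M \<eta>' n c \<rho> \<and> v = (\<Sum>k<n. chart_integral (c k) (\<rho> k) \<eta>'))" for v
    by (intro ex_cong1 conj_cong) simp_all
  then show ?thesis
    by (simp only: form_integral_def)
qed

lemma integral_wedge_cong:
  assumes "\<And>c p. c \<in> matlas M \<Longrightarrow> p \<in> fst c \<Longrightarrow> \<beta> c p = \<beta>' c p"
  shows "integral_wedge M Om \<beta> = integral_wedge M Om \<beta>'"
  unfolding integral_wedge_def by (rule form_integral_cong) (simp add: assms)


section \<open>The bulk-boundary relation\<close>

theorem proposition9p9:
  fixes M :: "('x, 'd::{finite, linorder}) cmanifold"
    and W :: "'x \<Rightarrow> complex"
    and Om :: "('x, 'd) chart \<Rightarrow> 'x \<Rightarrow> complex"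
    and G :: "('x, 'd) chart \<Rightarrow> 'x \<Rightarrow> 'd \<Rightarrow> 'd \<Rightarrow> complex"
    and E :: "('x, 'e) gbundle"
    and h D :: "('x, 'e) triv \<Rightarrow> 'x \<Rightarrow> nat \<Rightarrow> nat \<Rightarrow> complex"
    and lam :: real
    and \<omega> :: "('x, 'd) pv_field"
    and \<alpha> :: "('x, 'd, 'e) end_field"
  assumes "landau_ginzburg_pair M W"
    and "holomorphic_volume_form M Om"
    and "kaehler_metric M G"
    and "hermitian_factorization M W E h D"
    and "lam \<ge> 0"
    and "\<omega> \<in> PV_c M"
    and "\<alpha> \<in> A_End_c M E"
  shows "Tr_temp M W Om G lam (PV_mult \<omega> (f_B Om G E h D \<alpha>)) =
           tr_temp M W Om G E h D lam (PV_End_mult E (e_temp W Om G E h D lam \<omega>) \<alpha>) \<and>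
         tr_temp M W Om G E h D lam (PV_End_mult E (e_temp W Om G E h D lam \<omega>) \<alpha>) =
           integral_wedge M Om (lambda_Om E Om
             (PV_End_mult E
               (PV_End_mult E (End_of_PV (PV_mult (PV_exp (- lam) (L_G W G)) \<omega>))
                  (disk_kernel Om G E h D))
               \<alpha>))"
proof -
  define \<omega>' where "\<omega>' = PV_mult (PV_exp (- lam) (L_G W G)) \<omega>"
  define P where "P = disk_kernel Om G E h D"
  let ?rhs = "lambda_Om E Om (PV_End_mult E (PV_End_mult E (End_of_PV \<omega>') P) \<alpha>)"
  let ?frame = "\<lambda>p. SOME t. t \<in> trivs E \<and> p \<in> fst t"
  \<comment> \<open>The supertrace is evaluated in a chosen frame. The frame domains cover the manifold, so the frame
    chosen at \<open>p\<close> is indeed one over \<open>p\<close>, where the degree condition on \<open>\<alpha>\<close> applies.\<close>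
  have \<alpha>: "\<alpha> c (?frame p) p J I a b = 0"
    if "c \<in> matlas M" "p \<in> fst c" "I \<noteq> {}" "a < rk E" "b < rk E" for c p J I a b
  proof -
    have "p \<in> topspace (mtop M)"
      using assms(1) that(1,2) by (auto simp: landau_ginzburg_pair_def complex_manifold_def)
    moreover have "\<Union> (fst ` trivs E) = topspace (mtop M)"
      using assms(4) by (simp add: hermitian_factorization_def holomorphic_factorization_def
          holomorphic_graded_bundle_def)
    ultimately have "\<exists>t. t \<in> trivs E \<and> p \<in> fst t"
      by (metis UN_E)
    then have "?frame p \<in> trivs E \<and> p \<in> fst (?frame p)"
      by (rule someI_ex)
    with that assms(7) show ?thesis
      by (simp add: A_End_c_def)
  qed
  have "Tr_temp M W Om G lam (PV_mult \<omega> (f_B Om G E h D \<alpha>)) = integral_wedge M Om ?rhs"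
    by (simp add: Tr_temp_def f_B_def lambda_Om_def contract0_def supertrace_def PV_mult_def
        PV_End_mult_def End_of_PV_def bulk_integrand \<omega>'_def P_def)
  moreover have "tr_temp M W Om G E h D lam (PV_End_mult E (e_temp W Om G E h D lam \<omega>) \<alpha>) =
      integral_wedge M Om ?rhs"
    unfolding tr_temp_def
  proof (rule integral_wedge_cong)
    fix c p assume "c \<in> matlas M" "p \<in> fst c"
    then show "supertrace E (PV_End_mult E (PV_End_exp E (- lam) (L_a W G E h D))
        (PV_End_mult E (e_temp W Om G E h D lam \<omega>) \<alpha>)) c p = ?rhs c p"
      by (simp add: e_temp_def e_B_def lambda_Om_def contract0_def supertrace_def PV_End_mult_def
          PV_End_exp_def End_contract0_def boundary_integrand \<alpha> \<omega>'_def P_def)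
  qed
  ultimately show ?thesis
    by (simp add: \<omega>'_def P_def)
qed

end
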